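(* Let $N\in\mathbb{N}^*\cup\{+\infty\}$ and $I=\{1,2,\ldots,N\}$ (with $I=\mathbb{N}^*$ if $N=+\infty$). Let $Z=(Z_t)_{t\in[0,T]}$ be a centered Gaussian process on $(\Omega,\mathscr{F},\mathbf{P})$, with first Wiener chaos $\mathcal{H}_1(Z)$. Fix $t\in(0,T)$ and consider a subset $\{Y_i\}_{i\in I}$ of $\mathcal{H}_1(Z)$ such that, for every $n\in I$, the covariance matrix $M_n$ of $\{Y_i\}_{1\le i\le n}$ is invertible. Set $\mathscr{Y}=\sigma\{Y_i,\ i\in I\}$. Then: 1. If $\mathscr{Y}$ $\mathrm{L}^2$-differentiates $Z$ at $t$, then, for every $i\in I$, $Y_i$ $\mathrm{L}^2$-differentiates $Z$ at $t$. If $N<+\infty$, the converse also holds. 2. Suppose $N<+\infty$. Then $\mathscr{Y}$ really does not $\mathrm{L}^2\star\mathrm{a.s.}$-differentiate $Z$ at $t$ if, and only if, every finite linear combination of the $Y_i$'s either $\mathrm{L}^2\star\mathrm{a.s.}$-degenerates $Z$ at $t$ or does not $\mathrm{L}^2\star\mathrm{a.s.}$-differentiate $Z$ at $t$. 3. Suppose that $N=+\infty$ and that the sequence $\{Y_i\}_{i\in I}$ is i.i.d. Let $\mathbf{R}(\mathscr{Y})$ be the class of all sub-$\sigma$-fields of $\mathscr{Y}$ that are generated by rectangles, i.e. by events of the type $A_1\cap\cdots\cap A_d$ with $d\ge 1$ and $A_i\in\sigma\{Y_i\}$ for $i=1,\ldots,d$. (i) If $\mathscr{Y}$ really does not $\mathrm{L}^2\star\mathrm{a.s.}$-differentiate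 $Z$ at $t$, then every finite linear combination of the $Y_i$'s either $\mathrm{L}^2\star\mathrm{a.s.}$-degenerates $Z$ at $t$ or does not $\mathrm{L}^2\star\mathrm{a.s.}$-differentiate $Z$ at $t$. (ii) If every finite linear combination of the $Y_i$'s either $\mathrm{L}^2\star\mathrm{a.s.}$-degenerates $Z$ at $t$ or does not $\mathrm{L}^2\star\mathrm{a.s.}$-differentiate $Z$ at $t$, then every $\mathscr{G}\in\mathbf{R}(\mathscr{Y})$ either $\mathrm{L}^2\star\mathrm{a.s.}$-degenerates $Z$ at $t$ or does not $\mathrm{L}^2\star\mathrm{a.s.}$-differentiate $Z$ at $t$.
   Context: All processes are real-valued and defined on a probability space $(\Omega,\mathscr{F},\mathbf{P})$, with $Z_t\in\mathrm{L}^2(\Omega,\mathscr{F},\mathbf{P})$ for every $t\in[0,T]$; all $\sigma$-fields are sub-$\sigma$-fields of $\mathscr{F}$, and $\mathscr{H}\subset\mathscr{G}$ means that $\mathscr{H}$ is a sub-$\sigma$-field of $\mathscr{G}$. First Wiener chaos: for a centered Gaussian process $Z$, $\mathcal{H}_1(Z)$ is the $\mathrm{L}^2$-closed linear space generated by the random variables $Z_t$, $t\in[0,T]$. For $t\in(0,T)$ and $h\ne0$ with $t+h\in(0,T)$, set $\Delta_hZ_t=(Z_{t+h}-Z_t)/h$. Let $\tau$ be a mode of convergence; $\tau=\mathrm{L}^2$ is convergence in $\mathrm{L}^2(\mathbf{P})$, and $\tau=\mathrm{L}^2\star\mathrm{a.s.}$ means both $\mathrm{L}^2$ and almost sure convergence.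 - $\mathscr{G}$ $\tau$-differentiates $Z$ at $t$ if $\mathrm{E}[\Delta_hZ_t\mid\mathscr{G}]$ converges with respect to $\tau$ as $h\to0$; the limit is the $\tau$-stochastic derivative $D^{\mathscr{G}}Z_t$. Otherwise $\mathscr{G}$ does not $\tau$-differentiate $Z$ at $t$. Almost sure convergence is understood as follows: there is a jointly measurable map $(\omega,h)\mapsto q(\omega,h)$ from $\Omega\times(-\varepsilon,\varepsilon)$ to $\mathbb{R}$ such that $q(\cdot,h)$ is a version of $\mathrm{E}[\Delta_hZ_t\mid\mathscr{G}]$ for each fixed $h$, and there is a set $\Omega'$ of probability one such that $q(\omega,h)$ converges as $h\to0$ for every $\omega\in\Omega'$. - $\mathscr{G}$ $\tau$-degenerates $Z$ at $t$ if $\mathscr{G}$ $\tau$-differentiates $Z$ at $t$ and $D^{\mathscr{G}}Z_t=c$ a.s. for some constant $c\in\mathbb{R}$. - $\mathscr{G}$ really does not $\tau$-differentiate $Z$ at $t$ if $\mathscr{G}$ does not $\tau$-differentiate $Z$ at $t$ and every $\mathscr{H}\subset\mathscr{G}$ either $\tau$-degenerates $Z$ at $t$ or does not $\tau$-differentiate $Z$ at $t$. - A random variable $Y$ is said to $\tau$-differentiate (resp. $\tau$-degenerate) $Z$ at $t$ if $\sigma\{Y\}$ does.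
   Formalization: In item 2, the "if" direction is stated only when 𝒴 does not L²⋆a.s.-degenerate Z at t; without this it fails (Z Brownian motion, N=1, Y₁=Z_{t/2}: every linear combination degenerates Z, yet 𝒴 differentiates Z). *)

theory Defs
  imports "HOL-Probability.Probability" "Jordan_Normal_Form.Matrix"
begin

text \<open>A sub-\<open>\<sigma>\<close>-field of \<open>M\<close> is a measure \<open>G\<close> with \<open>subalgebra M G\<close>; only \<open>space G\<close> and \<open>sets G\<close>
  matter, both for \<open>subalgebra\<close> and for \<open>real_cond_exp M G\<close>.\<close>

subsection \<open>Square-integrable random variables\<close>

definition L2_space :: "'a measure \<Rightarrow> ('a \<Rightarrow> real) set" where
  "L2_space M = {X \<in> borel_measurable M. integrable M (\<lambda>\<omega>. (X \<omega>)\<^sup>2)}"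

definition L2_tendsto ::
  "'a measure \<Rightarrow> ('b \<Rightarrow> 'a \<Rightarrow> real) \<Rightarrow> ('a \<Rightarrow> real) \<Rightarrow> 'b filter \<Rightarrow> bool" where
  "L2_tendsto M f D F \<longleftrightarrow>
     D \<in> L2_space M \<and> (\<forall>\<^sub>F h in F. f h \<in> L2_space M) \<and>
     ((\<lambda>h. integral\<^sup>L M (\<lambda>\<omega>. (f h \<omega> - D \<omega>)\<^sup>2)) \<longlongrightarrow> 0) F"

definition covariance :: "'a measure \<Rightarrow> ('a \<Rightarrow> real) \<Rightarrow> ('a \<Rightarrow> real) \<Rightarrow> real" where
  "covariance M X Y =
     integral\<^sup>L M (\<lambda>\<omega>. (X \<omega> - integral\<^sup>L M X) * (Y \<omega> - integral\<^sup>L M Y))"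

text \<open>The matrix library indexes from 0, the family \<open>Y\<close> from 1.\<close>

definition cov_matrix :: "'a measure \<Rightarrow> (nat \<Rightarrow> 'a \<Rightarrow> real) \<Rightarrow> nat \<Rightarrow> real mat" where
  "cov_matrix M Y n = Matrix.mat n n (\<lambda>(i, j). covariance M (Y (Suc i)) (Y (Suc j)))"

subsection \<open>Gaussian processes and the first Wiener chaos\<close>

text \<open>Constants count as (degenerate) Gaussian variables, as is usual for Gaussian processes:
  Brownian motion has \<open>B\<^sub>0 = 0\<close>.\<close>

definition gaussian_rv :: "'a measure \<Rightarrow> ('a \<Rightarrow> real) \<Rightarrow> bool" where
  "gaussian_rv M X \<longleftrightarrow>
     (\<exists>\<mu> \<sigma>. 0 < \<sigma> \<and> distributed M lborel X (normal_density \<mu> \<sigma>)) \<or>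
     (X \<in> borel_measurable M \<and> (\<exists>\<mu>. AE \<omega> in M. X \<omega> = \<mu>))"

definition centered_gaussian_process ::
  "'a measure \<Rightarrow> real \<Rightarrow> (real \<Rightarrow> 'a \<Rightarrow> real) \<Rightarrow> bool" where
  "centered_gaussian_process M T Z \<longleftrightarrow>
     (\<forall>S c. finite S \<and> S \<subseteq> {0..T} \<longrightarrow> gaussian_rv M (\<lambda>\<omega>. \<Sum>s\<in>S. c s * Z s \<omega>)) \<and>
     (\<forall>s\<in>{0..T}. integral\<^sup>L M (Z s) = 0)"

definition first_chaos ::
  "'a measure \<Rightarrow> real \<Rightarrow> (real \<Rightarrow> 'a \<Rightarrow> real) \<Rightarrow> ('a \<Rightarrow> real) set" where
  "first_chaos M T Z =
     {X \<in> L2_space M. \<forall>e>0. \<exists>S c. finite S \<and> S \<subseteq> {0..T} \<and>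
        integral\<^sup>L M (\<lambda>\<omega>. (X \<omega> - (\<Sum>s\<in>S. c s * Z s \<omega>))\<^sup>2) < e}"

subsection \<open>Stochastic derivatives\<close>

datatype conv_mode = L2 | L2_as

definition diff_quot :: "(real \<Rightarrow> 'a \<Rightarrow> real) \<Rightarrow> real \<Rightarrow> real \<Rightarrow> 'a \<Rightarrow> real" where
  "diff_quot Z t h = (\<lambda>\<omega>. (Z (t + h) \<omega> - Z t \<omega>) / h)"

definition L2_stoch_deriv ::
  "'a measure \<Rightarrow> (real \<Rightarrow> 'a \<Rightarrow> real) \<Rightarrow> real \<Rightarrow> 'a measure \<Rightarrow> ('a \<Rightarrow> real) \<Rightarrow> bool" where
  "L2_stoch_deriv M Z t G D \<longleftrightarrow>
     L2_tendsto M (\<lambda>h. real_cond_exp M G (diff_quot Z t h)) D (at 0)"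

text \<open>The value \<open>q \<omega> 0\<close> is unconstrained up to joint measurability, since the difference quotient
  is defined for \<open>h \<noteq> 0\<close> only; the limit at 0 is the punctured one.\<close>

definition as_stoch_deriv ::
  "'a measure \<Rightarrow> real \<Rightarrow> (real \<Rightarrow> 'a \<Rightarrow> real) \<Rightarrow> real \<Rightarrow> 'a measure \<Rightarrow> ('a \<Rightarrow> real) \<Rightarrow> bool" where
  "as_stoch_deriv M T Z t G D \<longleftrightarrow>
     (\<exists>\<epsilon>>0. \<exists>q :: 'a \<Rightarrow> real \<Rightarrow> real.
        {t - \<epsilon><..<t + \<epsilon>} \<subseteq> {0<..<T} \<and>
        (\<lambda>(\<omega>, h). q \<omega> h) \<in> borel_measurable (M \<Otimes>\<^sub>M restrict_space borel {-\<epsilon><..<\<epsilon>}) \<and>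
        (\<forall>h\<in>{-\<epsilon><..<\<epsilon>} - {0}.
           (\<lambda>\<omega>. q \<omega> h) \<in> borel_measurable G \<and>
           (AE \<omega> in M. q \<omega> h = real_cond_exp M G (diff_quot Z t h) \<omega>)) \<and>
        (AE \<omega> in M. ((\<lambda>h. q \<omega> h) \<longlongrightarrow> D \<omega>) (at 0)))"

text \<open>\<open>D\<close> is determined only up to almost sure equality.\<close>

fun stoch_deriv ::
  "conv_mode \<Rightarrow> 'a measure \<Rightarrow> real \<Rightarrow> (real \<Rightarrow> 'a \<Rightarrow> real) \<Rightarrow> real \<Rightarrow> 'a measure \<Rightarrow> ('a \<Rightarrow> real) \<Rightarrow> bool"
where
  "stoch_deriv L2 M T Z t G D \<longleftrightarrow> L2_stoch_deriv M Z t G D"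
| "stoch_deriv L2_as M T Z t G D \<longleftrightarrow> L2_stoch_deriv M Z t G D \<and> as_stoch_deriv M T Z t G D"

definition differentiates ::
  "conv_mode \<Rightarrow> 'a measure \<Rightarrow> real \<Rightarrow> (real \<Rightarrow> 'a \<Rightarrow> real) \<Rightarrow> real \<Rightarrow> 'a measure \<Rightarrow> bool" where
  "differentiates \<tau> M T Z t G \<longleftrightarrow> (\<exists>D. stoch_deriv \<tau> M T Z t G D)"

definition degenerates ::
  "conv_mode \<Rightarrow> 'a measure \<Rightarrow> real \<Rightarrow> (real \<Rightarrow> 'a \<Rightarrow> real) \<Rightarrow> real \<Rightarrow> 'a measure \<Rightarrow> bool" where
  "degenerates \<tau> M T Z t G \<longleftrightarrow>
     (\<exists>D. stoch_deriv \<tau> M T Z t G D \<and> (\<exists>c::real. AE \<omega> in M. D \<omega> = c))"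

text \<open>A field that degenerates \<open>Z\<close> satisfies the second clause below but not the first. So a
  condition on sub-\<open>\<sigma>\<close>-fields or linear combinations of the form ``degenerates or does not
  differentiate'' can give the notion below only for fields that do not degenerate \<open>Z\<close>.\<close>

definition really_not_differentiates ::
  "conv_mode \<Rightarrow> 'a measure \<Rightarrow> real \<Rightarrow> (real \<Rightarrow> 'a \<Rightarrow> real) \<Rightarrow> real \<Rightarrow> 'a measure \<Rightarrow> bool" where
  "really_not_differentiates \<tau> M T Z t G \<longleftrightarrow>
     \<not> differentiates \<tau> M T Z t G \<and>
     (\<forall>H. subalgebra G H \<longrightarrow> degenerates \<tau> M T Z t H \<or> \<not> differentiates \<tau> M T Z t H)"

subsection \<open>Generated \<open>\<sigma>\<close>-fields and rectangles\<close>

definition sigma_rv :: "'a measure \<Rightarrow> ('a \<Rightarrow> real) \<Rightarrow> 'a measure" where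
  "sigma_rv M Y = vimage_algebra (space M) Y borel"

definition sigma_family :: "'a measure \<Rightarrow> (nat \<Rightarrow> 'a \<Rightarrow> real) \<Rightarrow> nat set \<Rightarrow> 'a measure" where
  "sigma_family M Y I = sigma (space M) (\<Union>i\<in>I. sets (sigma_rv M (Y i)))"

definition index_set :: "enat \<Rightarrow> nat set" where
  "index_set N = {i. 1 \<le> i \<and> enat i \<le> N}"

definition lin_comb :: "(nat \<Rightarrow> 'a \<Rightarrow> real) \<Rightarrow> nat set \<Rightarrow> (nat \<Rightarrow> real) \<Rightarrow> 'a \<Rightarrow> real" where
  "lin_comb Y J c = (\<lambda>\<omega>. \<Sum>j\<in>J. c j * Y j \<omega>)"

definition rectangles :: "'a measure \<Rightarrow> (nat \<Rightarrow> 'a \<Rightarrow> real) \<Rightarrow> 'a set set" where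
  "rectangles M Y =
     {(\<Inter>i\<in>{1..d}. A i) | d A. 1 \<le> d \<and> (\<forall>i\<in>{1..d}. A i \<in> sets (sigma_rv M (Y i)))}"

text \<open>Intended for families indexed by all positive integers.\<close>

definition rectangle_subalgebras :: "'a measure \<Rightarrow> (nat \<Rightarrow> 'a \<Rightarrow> real) \<Rightarrow> 'a measure set" where
  "rectangle_subalgebras M Y =
     {G. subalgebra (sigma_family M Y {1..}) G \<and>
         (\<exists>C \<subseteq> rectangles M Y. sets G = sigma_sets (space M) C)}"

definition iid_family :: "'a measure \<Rightarrow> (nat \<Rightarrow> 'a \<Rightarrow> real) \<Rightarrow> nat set \<Rightarrow> bool" where
  "iid_family M Y I \<longleftrightarrow>
     prob_space.indep_vars M (\<lambda>_. borel) Y I \<and>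
     (\<forall>i\<in>I. \<forall>j\<in>I. distr M borel (Y i) = distr M borel (Y j))"

end

theory Submission
  imports Defs
begin

text \<open>Two facts drive the proof. First, in the Gaussian space \<open>first_chaos M T Z\<close>, orthogonality to
  finitely many \<open>Y\<^sub>j\<close> forces zero integral over every event of \<open>\<sigma>(Y\<^sub>j)\<close>, so conditioning on
  \<open>\<sigma>(Y\<^sub>1, \<dots>, Y\<^sub>n)\<close> is orthogonal projection; part 1 is then the convergence of finitely many
  regression coefficients.

  Second, for an event \<open>A \<in> \<sigma>(Y\<^sub>1, \<dots>, Y\<^sub>n)\<close> let \<open>\<xi>\<close> be the projection of its indicator onto the span
  of the \<open>Y\<^sub>j\<close>: then \<open>E (X 1\<^sub>A) = E (X \<xi>)\<close> for all \<open>X\<close> in the chaos. If \<open>G\<close> differentiates \<open>Z\<close> with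
  derivative \<open>D\<close> and \<open>A \<in> G\<close>, then \<open>E (\<Delta>\<^sub>h Z\<^sub>t \<xi>)\<close> tends to \<open>E (D 1\<^sub>A)\<close>; were this limit nonzero, \<open>\<xi>\<close> would be
  a linear combination that differentiates \<open>Z\<close> without degenerating it. So \<open>D\<close> integrates to zero over
  a generating \<open>\<pi>\<close>-system of \<open>G\<close>, hence \<open>D = 0\<close>. For rectangles the \<open>\<pi>\<close>-system consists of the events
  of \<open>G\<close> that depend on finitely many coordinates.\<close>

section \<open>Square-integrable random variables\<close>

context prob_space
begin

lemma L2_space_measurable [measurable_dest]: "X \<in> L2_space M \<Longrightarrow> X \<in> borel_measurable M"
  by (simp add: L2_space_def)

lemma L2_space_square_integrable: "X \<in> L2_space M \<Longrightarrow> integrable M (\<lambda>\<omega>. (X \<omega>)\<^sup>2)"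
  by (simp add: L2_space_def)

lemma L2_space_integrable: "X \<in> L2_space M \<Longrightarrow> integrable M X"
  by (auto simp: L2_space_def intro: square_integrable_imp_integrable)

lemma L2_space_mult_integrable:
  assumes X: "X \<in> L2_space M" and Y: "Y \<in> L2_space M"
  shows "integrable M (\<lambda>\<omega>. X \<omega> * Y \<omega>)"
proof (rule Bochner_Integration.integrable_bound)
  show "integrable M (\<lambda>\<omega>. (X \<omega>)\<^sup>2 + (Y \<omega>)\<^sup>2)"
    using X Y by (simp add: L2_space_square_integrable)
  show "(\<lambda>\<omega>. X \<omega> * Y \<omega>) \<in> borel_measurable M"
    using X Y by measurable
  have "\<bar>a * b\<bar> \<le> a\<^sup>2 + b\<^sup>2" for a b :: real
    using sum_squares_bound[of "\<bar>a\<bar>" "\<bar>b\<bar>", unfolded power2_abs mult.assoc]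
      abs_ge_zero[of "a * b"] unfolding abs_mult by linarith
  then show "AE \<omega> in M. norm (X \<omega> * Y \<omega>) \<le> norm ((X \<omega>)\<^sup>2 + (Y \<omega>)\<^sup>2)"
    by simp
qed

lemma L2_space_add:
  assumes X: "X \<in> L2_space M" and Y: "Y \<in> L2_space M"
  shows "(\<lambda>\<omega>. X \<omega> + Y \<omega>) \<in> L2_space M"
proof -
  have "integrable M (\<lambda>\<omega>. (X \<omega>)\<^sup>2 + (Y \<omega>)\<^sup>2 + 2 * (X \<omega> * Y \<omega>))"
    using X Y by (intro Bochner_Integration.integrable_add integrable_mult_right
        L2_space_square_integrable L2_space_mult_integrable)
  then show ?thesis
    using X Y by (auto simp: L2_space_def power2_sum mult.assoc)
qed

lemma L2_space_scale: "X \<in> L2_space M \<Longrightarrow> (\<lambda>\<omega>. c * X \<omega>) \<in> L2_space M"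
  by (auto simp: L2_space_def power_mult_distrib)

lemma L2_space_diff:
  assumes "X \<in> L2_space M" "Y \<in> L2_space M"
  shows "(\<lambda>\<omega>. X \<omega> - Y \<omega>) \<in> L2_space M"
  using L2_space_add[OF assms(1) L2_space_scale[OF assms(2), of "-1"]] by simp

lemma L2_space_zero: "(\<lambda>\<omega>. 0) \<in> L2_space M"
  by (simp add: L2_space_def)

lemma L2_space_sum:
  "(\<And>j. j \<in> J \<Longrightarrow> X j \<in> L2_space M) \<Longrightarrow> (\<lambda>\<omega>. \<Sum>j\<in>J. X j \<omega>) \<in> L2_space M"
  by (induction J rule: infinite_finite_induct) (auto simp: L2_space_zero L2_space_add)

lemma L2_space_indicator: "A \<in> sets M \<Longrightarrow> indicator A \<in> L2_space M"
  by (simp add: L2_space_def power2_eq_square less_top[symmetric] flip: indicator_inter_arith)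

lemma L2_space_cong_AE:
  assumes "X \<in> L2_space M" "Y \<in> borel_measurable M" "AE \<omega> in M. Y \<omega> = X \<omega>"
  shows "Y \<in> L2_space M"
proof -
  have "integrable M (\<lambda>\<omega>. (X \<omega>)\<^sup>2)"
    using assms(1) by (rule L2_space_square_integrable)
  then have "integrable M (\<lambda>\<omega>. (Y \<omega>)\<^sup>2)"
    by (rule integrable_cong_AE_imp) (use assms in auto)
  then show ?thesis
    using assms(2) by (simp add: L2_space_def)
qed

text \<open>Expanding \<open>E (a X - b Y)^2 \<ge> 0\<close> with \<open>a = E Y^2\<close> and
  \<open>b = E (X Y)\<close> gives \<open>a (a E X^2 - b^2) \<ge> 0\<close>. Cancelling
  \<open>a\<close> needs \<open>a > 0\<close>; if \<open>a = 0\<close>, then \<open>Y\<close>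
  vanishes almost surely and \<open>b = 0\<close>.\<close>

lemma L2_Cauchy_Schwarz:
  assumes X: "X \<in> L2_space M" and Y: "Y \<in> L2_space M"
  shows "(expectation (\<lambda>\<omega>. X \<omega> * Y \<omega>))\<^sup>2
    \<le> expectation (\<lambda>\<omega>. (X \<omega>)\<^sup>2) * expectation (\<lambda>\<omega>. (Y \<omega>)\<^sup>2)"
proof -
  define a where "a = expectation (\<lambda>\<omega>. (Y \<omega>)\<^sup>2)"
  define b where "b = expectation (\<lambda>\<omega>. X \<omega> * Y \<omega>)"
  note int = L2_space_square_integrable[OF X] L2_space_square_integrable[OF Y]
    L2_space_mult_integrable[OF X Y]
  show ?thesis
  proof (cases "a = 0")
    case True
    then have "AE \<omega> in M. (Y \<omega>)\<^sup>2 = 0"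
      using integral_nonneg_eq_0_iff_AE[OF int(2)] by (simp add: a_def)
    then have "AE \<omega> in M. X \<omega> * Y \<omega> = 0"
      by eventually_elim simp
    then have "b = 0"
      unfolding b_def by (rule integral_eq_zero_AE)
    then show ?thesis
      by (simp add: b_def)
  next
    case False
    then have "a > 0"
      by (simp add: a_def order_less_le)
    have "0 \<le> expectation (\<lambda>\<omega>. (a * X \<omega> - b * Y \<omega>)\<^sup>2)"
      by simp
    also have "(\<lambda>\<omega>. (a * X \<omega> - b * Y \<omega>)\<^sup>2) =
        (\<lambda>\<omega>. a\<^sup>2 * (X \<omega>)\<^sup>2 - 2 * a * b * (X \<omega> * Y \<omega>) + b\<^sup>2 * (Y \<omega>)\<^sup>2)"
      by (simp add: fun_eq_iff power2_diff power_mult_distrib algebra_simps)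
    also have "expectation \<dots> = a\<^sup>2 * expectation (\<lambda>\<omega>. (X \<omega>)\<^sup>2) - 2 * a * b * b + b\<^sup>2 * a"
      using int by (simp add: a_def b_def)
    also have "\<dots> = a * (expectation (\<lambda>\<omega>. (X \<omega>)\<^sup>2) * a - b\<^sup>2)"
      by (simp add: power2_eq_square algebra_simps)
    finally show ?thesis
      using \<open>a > 0\<close> by (simp add: zero_le_mult_iff a_def b_def)
  qed
qed

text \<open>Strong convergence implies weak convergence, by Cauchy-Schwarz. The limits of
  covariances below come from here.\<close>

lemma L2_tendsto_integral_mult:
  assumes f: "L2_tendsto M f D F" and V: "V \<in> L2_space M"
  shows "((\<lambda>h. expectation (\<lambda>\<omega>. f h \<omega> * V \<omega>)) \<longlongrightarrow> expectation (\<lambda>\<omega>. D \<omega> * V \<omega>)) F"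
proof -
  let ?d = "\<lambda>h. expectation (\<lambda>\<omega>. f h \<omega> * V \<omega>) - expectation (\<lambda>\<omega>. D \<omega> * V \<omega>)"
  let ?n = "\<lambda>h. expectation (\<lambda>\<omega>. (f h \<omega> - D \<omega>)\<^sup>2)"
  have D: "D \<in> L2_space M" and ev: "\<forall>\<^sub>F h in F. f h \<in> L2_space M"
    and lim: "(?n \<longlongrightarrow> 0) F"
    using f by (auto simp: L2_tendsto_def)
  have "\<forall>\<^sub>F h in F. norm (?d h) \<le> sqrt (?n h * expectation (\<lambda>\<omega>. (V \<omega>)\<^sup>2))"
    using ev
  proof eventually_elim
    case (elim h)
    have "?d h = expectation (\<lambda>\<omega>. (f h \<omega> - D \<omega>) * V \<omega>)"
      using elim D V by (simp add: left_diff_distrib L2_space_mult_integrable)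
    with L2_Cauchy_Schwarz[OF L2_space_diff[OF elim D] V] show ?case
      by (simp add: real_le_rsqrt)
  qed
  moreover have "((\<lambda>h. sqrt (?n h * expectation (\<lambda>\<omega>. (V \<omega>)\<^sup>2))) \<longlongrightarrow> 0) F"
    using tendsto_real_sqrt[OF tendsto_mult_left_zero[OF lim]] by simp
  ultimately have "(?d \<longlongrightarrow> 0) F"
    by (rule Lim_null_comparison)
  then show ?thesis
    by (simp add: LIM_zero_iff)
qed

lemma lin_comb_L2_space:
  "(\<And>j. j \<in> J \<Longrightarrow> Y j \<in> L2_space M) \<Longrightarrow> lin_comb Y J c \<in> L2_space M"
  unfolding lin_comb_def by (intro L2_space_sum L2_space_scale)

lemma expectation_mult_lin_comb:
  assumes "U \<in> L2_space M" "\<And>j. j \<in> J \<Longrightarrow> Y j \<in> L2_space M"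
  shows "expectation (\<lambda>\<omega>. U \<omega> * lin_comb Y J c \<omega>)
    = (\<Sum>j\<in>J. c j * expectation (\<lambda>\<omega>. U \<omega> * Y j \<omega>))"
proof -
  have "(\<lambda>\<omega>. U \<omega> * lin_comb Y J c \<omega>) = (\<lambda>\<omega>. \<Sum>j\<in>J. c j * (U \<omega> * Y j \<omega>))"
    by (simp add: lin_comb_def fun_eq_iff sum_distrib_left mult_ac)
  then show ?thesis
    using assms by (simp add: Bochner_Integration.integral_sum L2_space_mult_integrable)
qed

text \<open>The squared distance is a quadratic form in the differences \<open>c h j - d j\<close>,
  with the second moments of \<open>Y\<close> as its fixed matrix, so convergence of the
  coefficients suffices.\<close>

lemma L2_tendsto_lin_comb:
  assumes Y: "\<And>j. j \<in> J \<Longrightarrow> Y j \<in> L2_space M"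
    and c: "\<And>j. j \<in> J \<Longrightarrow> ((\<lambda>h. c h j) \<longlongrightarrow> d j) F"
  shows "L2_tendsto M (\<lambda>h. lin_comb Y J (c h)) (lin_comb Y J d) F"
proof -
  let ?r = "\<lambda>h. lin_comb Y J (\<lambda>j. c h j - d j)"
  have "expectation (\<lambda>\<omega>. (lin_comb Y J (c h) \<omega> - lin_comb Y J d \<omega>)\<^sup>2)
      = (\<Sum>i\<in>J. \<Sum>j\<in>J. (c h i - d i) * ((c h j - d j) * expectation (\<lambda>\<omega>. Y i \<omega> * Y j \<omega>)))" for h
  proof -
    have "expectation (\<lambda>\<omega>. (lin_comb Y J (c h) \<omega> - lin_comb Y J d \<omega>)\<^sup>2)
        = expectation (\<lambda>\<omega>. ?r h \<omega> * ?r h \<omega>)"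
      by (simp add: lin_comb_def power2_eq_square left_diff_distrib sum_subtractf)
    also have "\<dots> = (\<Sum>i\<in>J. (c h i - d i) * expectation (\<lambda>\<omega>. ?r h \<omega> * Y i \<omega>))"
      using Y by (intro expectation_mult_lin_comb lin_comb_L2_space)
    also have "\<dots> = (\<Sum>i\<in>J. (c h i - d i) * (\<Sum>j\<in>J. (c h j - d j) * expectation (\<lambda>\<omega>. Y i \<omega> * Y j \<omega>)))"
      using Y by (simp add: mult.commute[of "?r h _"] expectation_mult_lin_comb)
    finally show ?thesis
      by (simp add: sum_distrib_left)
  qed
  moreover have "((\<lambda>h. \<Sum>i\<in>J. \<Sum>j\<in>J. (c h i - d i) * ((c h j - d j) * expectation (\<lambda>\<omega>. Y i \<omega> * Y j \<omega>))) \<longlongrightarrow> 0) F"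
    by (intro tendsto_null_sum tendsto_mult_zero tendsto_mult_left_zero LIM_zero c)
  ultimately show ?thesis
    using Y by (simp add: L2_tendsto_def lin_comb_L2_space)
qed

text \<open>Conditional expectations are computed only up to null sets; this carries a limit from
  explicit versions to \<open>real_cond_exp\<close>.\<close>

lemma L2_tendsto_cong_AE:
  assumes "L2_tendsto M f D F"
    and "\<forall>\<^sub>F h in F. g h \<in> borel_measurable M \<and> (AE \<omega> in M. g h \<omega> = f h \<omega>)"
  shows "L2_tendsto M g D F"
proof -
  have D: "D \<in> L2_space M" and f: "\<forall>\<^sub>F h in F. f h \<in> L2_space M"
    and lim: "((\<lambda>h. expectation (\<lambda>\<omega>. (f h \<omega> - D \<omega>)\<^sup>2)) \<longlongrightarrow> 0) F"
    using assms(1) by (auto simp: L2_tendsto_def)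
  have "\<forall>\<^sub>F h in F. g h \<in> L2_space M"
    using f assms(2) by eventually_elim (blast intro: L2_space_cong_AE)
  moreover have "\<forall>\<^sub>F h in F. expectation (\<lambda>\<omega>. (f h \<omega> - D \<omega>)\<^sup>2) = expectation (\<lambda>\<omega>. (g h \<omega> - D \<omega>)\<^sup>2)"
    using f assms(2)
  proof eventually_elim
    case (elim h)
    show ?case
      by (rule integral_cong_AE) (use elim D in auto)
  qed
  ultimately show ?thesis
    using D Lim_transform_eventually[OF lim] by (simp add: L2_tendsto_def)
qed

end

section \<open>Characteristic functions of centered Gaussian variables\<close>

text \<open>Pull out the factor \<open>iexp y\<close> of modulus 1 and bound the zeroth Taylor
  remainder of \<open>iexp\<close> at \<open>x - y\<close>.\<close>

lemma norm_iexp_diff_le: "norm (iexp x - iexp y) \<le> \<bar>x - y\<bar>"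
proof -
  have "iexp x - iexp y = iexp y * (iexp (x - y) - 1)"
    by (simp add: algebra_simps flip: exp_add)
  then show ?thesis
    using iexp_approx1[of "x - y" 0] by (simp add: norm_mult)
qed

context prob_space
begin

text \<open>Gaussianity through the characteristic function: the formula covers the constant zero
  along with the normal laws, and it survives L2 limits, where a density may be lost.\<close>

definition centered_gaussian_char :: "('a \<Rightarrow> real) \<Rightarrow> bool" where
  "centered_gaussian_char X \<longleftrightarrow> X \<in> L2_space M \<and>
     (\<forall>a. (CLINT \<omega>|M. iexp (a * X \<omega>))
       = complex_of_real (exp (- (a\<^sup>2 * expectation (\<lambda>\<omega>. (X \<omega>)\<^sup>2)) / 2)))"

text \<open>In the nondegenerate case the variable is scaled to a standard normal one. An almost
  surely constant variable of mean zero is zero, and then both sides equal 1.\<close>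

lemma gaussian_rv_centered_char:
  assumes X: "X \<in> L2_space M" and g: "gaussian_rv M X" and mean: "expectation X = 0"
  shows "centered_gaussian_char X"
proof -
  have "(CLINT \<omega>|M. iexp (a * X \<omega>))
      = complex_of_real (exp (- (a\<^sup>2 * expectation (\<lambda>\<omega>. (X \<omega>)\<^sup>2)) / 2))" for a
    using g unfolding gaussian_rv_def
  proof (elim disjE exE conjE)
    fix \<mu> \<sigma> assume \<sigma>: "0 < \<sigma>" and d: "distributed M lborel X (normal_density \<mu> \<sigma>)"
    have \<mu>: "\<mu> = 0"
      using normal_distributed_expectation[OF \<sigma> d] mean by simp
    have var: "expectation (\<lambda>\<omega>. (X \<omega>)\<^sup>2) = \<sigma>\<^sup>2"
      using normal_distributed_variance[OF \<sigma> d] mean by simp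
    have s: "distributed M lborel (\<lambda>\<omega>. X \<omega> / \<sigma>) std_normal_density"
      using normal_standard_normal_convert[OF \<sigma>, of X \<mu>] d \<mu> by simp
    have [measurable]: "X \<in> borel_measurable M"
      using X by measurable
    have "(CLINT \<omega>|M. iexp (a * X \<omega>)) = (CLINT \<omega>|M. iexp (a * \<sigma> * (X \<omega> / \<sigma>)))"
      using \<sigma> by simp
    also have "\<dots> = (CLINT x|distr M lborel (\<lambda>\<omega>. X \<omega> / \<sigma>). iexp (a * \<sigma> * x))"
      by (subst integral_distr) auto
    also have "\<dots> = char std_normal_distribution (a * \<sigma>)"
      using distributed_distr_eq_density[OF s] by (simp add: char_def)
    finally show ?thesis
      by (simp add: char_std_normal_distribution var power_mult_distrib)
  next
    fix \<mu> assume c: "AE \<omega> in M. X \<omega> = \<mu>"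
    have "expectation X = expectation (\<lambda>_. \<mu>)"
      by (rule integral_cong_AE) (use X c in auto)
    then have c: "AE \<omega> in M. X \<omega> = 0"
      using c mean by (simp add: prob_space)
    then have "expectation (\<lambda>\<omega>. (X \<omega>)\<^sup>2) = 0"
      by (intro integral_eq_zero_AE) auto
    moreover have "(CLINT \<omega>|M. iexp (a * X \<omega>)) = (CLINT \<omega>|M. 1)"
      by (rule integral_cong_AE) (use X c in auto)
    ultimately show ?thesis
      by (simp add: prob_space)
  qed
  then show ?thesis
    using X by (simp add: centered_gaussian_char_def)
qed

text \<open>Second moments and characteristic functions both pass to the limit, the latter because
  \<open>iexp\<close> is Lipschitz and the L1 distance is at most the L2 distance.\<close>

lemma centered_gaussian_char_L2_limit:
  assumes X: "X \<in> L2_space M"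
    and approx: "\<And>e. e > 0 \<Longrightarrow> \<exists>W. centered_gaussian_char W \<and> expectation (\<lambda>\<omega>. (X \<omega> - W \<omega>)\<^sup>2) < e"
  shows "centered_gaussian_char X"
proof -
  have "\<forall>n. \<exists>W. centered_gaussian_char W \<and>
      expectation (\<lambda>\<omega>. (X \<omega> - W \<omega>)\<^sup>2) < inverse (real (Suc n))"
    by (intro allI approx) simp
  then obtain W where W: "\<And>n. centered_gaussian_char (W n)"
    and close: "\<And>n. expectation (\<lambda>\<omega>. (X \<omega> - W n \<omega>)\<^sup>2) < inverse (real (Suc n))"
    by metis
  have W2: "W n \<in> L2_space M" for n
    using W by (simp add: centered_gaussian_char_def)
  let ?e = "\<lambda>n. expectation (\<lambda>\<omega>. (W n \<omega> - X \<omega>)\<^sup>2)"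
  have e0: "?e \<longlonglongrightarrow> 0"
  proof (rule real_tendsto_sandwich[OF _ _ tendsto_const LIMSEQ_inverse_real_of_nat])
    show "\<forall>\<^sub>F n in sequentially. ?e n \<le> inverse (real (Suc n))"
      using close by (simp add: less_imp_le power2_commute[of "W _ _"])
  qed simp
  then have lim: "L2_tendsto M W X sequentially"
    using X W2 by (simp add: L2_tendsto_def)
  \<comment> \<open>\<open>E (W n)^2\<close> is rewritten as
    \<open>E (W n - X)^2 + 2 E (W n X) - E X^2\<close>, whose terms have known limits.\<close>
  have "(\<lambda>n. ?e n + 2 * expectation (\<lambda>\<omega>. W n \<omega> * X \<omega>) - expectation (\<lambda>\<omega>. X \<omega> * X \<omega>))
      \<longlonglongrightarrow> 0 + 2 * expectation (\<lambda>\<omega>. X \<omega> * X \<omega>) - expectation (\<lambda>\<omega>. X \<omega> * X \<omega>)"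
    by (intro tendsto_intros e0 L2_tendsto_integral_mult lim X)
  moreover have "?e n + 2 * expectation (\<lambda>\<omega>. W n \<omega> * X \<omega>) - expectation (\<lambda>\<omega>. X \<omega> * X \<omega>)
      = expectation (\<lambda>\<omega>. (W n \<omega>)\<^sup>2)" for n
  proof -
    have "(\<lambda>\<omega>. (W n \<omega> - X \<omega>)\<^sup>2) = (\<lambda>\<omega>. (W n \<omega>)\<^sup>2 - 2 * (W n \<omega> * X \<omega>) + X \<omega> * X \<omega>)"
      by (simp add: fun_eq_iff power2_eq_square algebra_simps)
    then show ?thesis
      using L2_space_mult_integrable[OF X X] L2_space_mult_integrable[OF W2[of n] X]
        L2_space_square_integrable[OF W2[of n]] by simp
  qed
  ultimately have var: "(\<lambda>n. expectation (\<lambda>\<omega>. (W n \<omega>)\<^sup>2)) \<longlonglongrightarrow> expectation (\<lambda>\<omega>. (X \<omega>)\<^sup>2)"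
    by (simp add: power2_eq_square)
  have "(CLINT \<omega>|M. iexp (a * X \<omega>))
      = complex_of_real (exp (- (a\<^sup>2 * expectation (\<lambda>\<omega>. (X \<omega>)\<^sup>2)) / 2))" for a
  proof (rule LIMSEQ_unique)
    have iexp_int: "integrable M (\<lambda>\<omega>. iexp (a * U \<omega>))" if "U \<in> L2_space M" for U
      by (rule integrable_iexp) (use that in auto)
    have "norm ((CLINT \<omega>|M. iexp (a * W n \<omega>)) - (CLINT \<omega>|M. iexp (a * X \<omega>))) \<le> \<bar>a\<bar> * sqrt (?e n)"
      for n
    proof -
      have d: "(\<lambda>\<omega>. \<bar>W n \<omega> - X \<omega>\<bar>) \<in> L2_space M"
        using L2_space_diff[OF W2[of n] X] by (auto simp: L2_space_def)
      \<comment> \<open>Pairing with the constant 1 turns Cauchy-Schwarz into the bound of the L1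
        norm by the L2 norm.\<close>
      have one: "(\<lambda>\<omega>. 1) \<in> L2_space M"
        by (simp add: L2_space_def)
      have "norm ((CLINT \<omega>|M. iexp (a * W n \<omega>)) - (CLINT \<omega>|M. iexp (a * X \<omega>)))
          = norm (CLINT \<omega>|M. iexp (a * W n \<omega>) - iexp (a * X \<omega>))"
        using iexp_int[OF X] iexp_int[OF W2[of n]] by (subst Bochner_Integration.integral_diff) auto
      moreover have "norm (CLINT \<omega>|M. iexp (a * W n \<omega>) - iexp (a * X \<omega>))
          \<le> expectation (\<lambda>\<omega>. norm (iexp (a * W n \<omega>) - iexp (a * X \<omega>)))"
        by (rule integral_norm_bound)
      moreover have "expectation (\<lambda>\<omega>. norm (iexp (a * W n \<omega>) - iexp (a * X \<omega>)))
          \<le> expectation (\<lambda>\<omega>. \<bar>a\<bar> * \<bar>W n \<omega> - X \<omega>\<bar>)"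
      proof (rule integral_mono)
        show "integrable M (\<lambda>\<omega>. norm (iexp (a * W n \<omega>) - iexp (a * X \<omega>)))"
          using iexp_int[OF X] iexp_int[OF W2[of n]] by auto
        show "integrable M (\<lambda>\<omega>. \<bar>a\<bar> * \<bar>W n \<omega> - X \<omega>\<bar>)"
          using L2_space_integrable[OF d] by simp
        show "norm (iexp (a * W n \<omega>) - iexp (a * X \<omega>)) \<le> \<bar>a\<bar> * \<bar>W n \<omega> - X \<omega>\<bar>" for \<omega>
        proof -
          have "\<bar>a * W n \<omega> - a * X \<omega>\<bar> = \<bar>a\<bar> * \<bar>W n \<omega> - X \<omega>\<bar>"
            by (metis abs_mult right_diff_distrib)
          then show ?thesis
            using norm_iexp_diff_le[of "a * W n \<omega>" "a * X \<omega>"] by simp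
        qed
      qed
      moreover have "expectation (\<lambda>\<omega>. \<bar>a\<bar> * \<bar>W n \<omega> - X \<omega>\<bar>) \<le> \<bar>a\<bar> * sqrt (?e n)"
      proof -
        have "expectation (\<lambda>\<omega>. \<bar>W n \<omega> - X \<omega>\<bar>) \<le> sqrt (?e n)"
          using L2_Cauchy_Schwarz[OF d one] by (intro real_le_rsqrt) (simp add: prob_space)
        then show ?thesis
          by (simp add: mult_left_mono)
      qed
      ultimately show ?thesis
        by linarith
    qed
    moreover have "(\<lambda>n. \<bar>a\<bar> * sqrt (?e n)) \<longlonglongrightarrow> 0"
      using tendsto_mult_right_zero[OF tendsto_real_sqrt[OF e0, simplified]] by simp
    ultimately have "(\<lambda>n. (CLINT \<omega>|M. iexp (a * W n \<omega>)) - (CLINT \<omega>|M. iexp (a * X \<omega>))) \<longlonglongrightarrow> 0"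
      by (rule Lim_null_comparison[OF always_eventually, OF allI])
    then show "(\<lambda>n. CLINT \<omega>|M. iexp (a * W n \<omega>)) \<longlonglongrightarrow> (CLINT \<omega>|M. iexp (a * X \<omega>))"
      by (rule LIM_zero_cancel)
    have "(\<lambda>n. complex_of_real (exp (- (a\<^sup>2 * expectation (\<lambda>\<omega>. (W n \<omega>)\<^sup>2)) / 2)))
        \<longlonglongrightarrow> complex_of_real (exp (- (a\<^sup>2 * expectation (\<lambda>\<omega>. (X \<omega>)\<^sup>2)) / 2))"
      by (intro tendsto_intros var) simp
    then show "(\<lambda>n. CLINT \<omega>|M. iexp (a * W n \<omega>))
        \<longlonglongrightarrow> complex_of_real (exp (- (a\<^sup>2 * expectation (\<lambda>\<omega>. (X \<omega>)\<^sup>2)) / 2))"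
      using W by (simp add: centered_gaussian_char_def)
  qed
  then show ?thesis
    using X by (simp add: centered_gaussian_char_def)
qed

text \<open>Differentiate \<open>a \<mapsto> E (iexp (a X + S))\<close> at \<open>a = 0\<close>; by orthogonality it is an even
  function of \<open>a\<close>.\<close>

lemma integral_mult_iexp_orthogonal:
  assumes X: "X \<in> L2_space M" and S: "S \<in> L2_space M"
    and joint: "\<And>a. centered_gaussian_char (\<lambda>\<omega>. a * X \<omega> + S \<omega>)"
    and orth: "expectation (\<lambda>\<omega>. X \<omega> * S \<omega>) = 0"
  shows "(CLINT \<omega>|M. complex_of_real (X \<omega>) * iexp (S \<omega>)) = 0"
proof -
  define v where "v = expectation (\<lambda>\<omega>. (X \<omega>)\<^sup>2)"
  define w where "w = expectation (\<lambda>\<omega>. (S \<omega>)\<^sup>2)"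
  \<comment> \<open>By orthogonality \<open>a X + S\<close> has variance \<open>a^2 v + w\<close>,
    so \<open>g a\<close> is the value at 1 of its characteristic function.\<close>
  define g where "g a = exp (- (a\<^sup>2 * v + w) / 2)" for a :: real
  define r where "r n = inverse (real (Suc n))" for n
  have r0: "r \<longlonglongrightarrow> 0" and rpos: "r n > 0" for n
    using LIMSEQ_inverse_real_of_nat by (simp_all add: r_def[abs_def])
  have rne: "r n \<noteq> 0" for n
    using rpos[of n] by simp
  have [measurable]: "X \<in> borel_measurable M" "S \<in> borel_measurable M"
    using X S by auto
  have g: "(CLINT \<omega>|M. iexp (a * X \<omega> + S \<omega>)) = complex_of_real (g a)" for a
  proof -
    have "expectation (\<lambda>\<omega>. (a * X \<omega> + S \<omega>)\<^sup>2)
        = expectation (\<lambda>\<omega>. a\<^sup>2 * (X \<omega>)\<^sup>2 + 2 * a * (X \<omega> * S \<omega>) + (S \<omega>)\<^sup>2)"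
      by (simp add: power2_sum power_mult_distrib algebra_simps)
    also have "\<dots> = a\<^sup>2 * v + w"
      using X S orth by (simp add: L2_space_square_integrable L2_space_mult_integrable v_def w_def)
    finally show ?thesis
      using joint[of a, unfolded centered_gaussian_char_def, THEN conjunct2, rule_format, of 1]
      by (simp add: g_def)
  qed
  \<comment> \<open>This is the difference quotient at 0 of
    \<open>a \<mapsto> iexp (a X + S)\<close> along the null sequence \<open>r\<close>; by the
    Lipschitz bound \<open>\<bar>X\<bar>\<close> dominates it.\<close>
  define f where "f n \<omega> = (iexp (r n * X \<omega>) - 1) / complex_of_real (r n) * iexp (S \<omega>)" for n \<omega>
  have "(\<lambda>n. CLINT \<omega>|M. f n \<omega>) \<longlonglongrightarrow> (CLINT \<omega>|M. \<i> * complex_of_real (X \<omega>) * iexp (S \<omega>))"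
  proof (rule integral_dominated_convergence)
    show "integrable M (\<lambda>\<omega>. \<bar>X \<omega>\<bar>)"
      using X by (simp add: L2_space_integrable)
    show "AE \<omega> in M. norm (f n \<omega>) \<le> \<bar>X \<omega>\<bar>" for n
    proof (rule AE_I2)
      fix \<omega>
      have "norm (iexp (r n * X \<omega>) - 1) \<le> r n * \<bar>X \<omega>\<bar>"
        using norm_iexp_diff_le[of "r n * X \<omega>" 0] rpos[of n] by (simp add: abs_mult)
      then show "norm (f n \<omega>) \<le> \<bar>X \<omega>\<bar>"
        using rpos[of n] by (simp add: f_def norm_mult norm_divide divide_le_eq mult.commute)
    qed
    show "AE \<omega> in M. (\<lambda>n. f n \<omega>) \<longlonglongrightarrow> \<i> * complex_of_real (X \<omega>) * iexp (S \<omega>)"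
    proof (rule AE_I2)
      fix \<omega>
      have "((\<lambda>z. exp (\<i> * complex_of_real (X \<omega>) * z)) has_field_derivative \<i> * complex_of_real (X \<omega>)) (at 0)"
        by (auto intro!: derivative_eq_intros)
      then have "((\<lambda>z. (exp (\<i> * complex_of_real (X \<omega>) * z) - 1) / z) \<longlongrightarrow> \<i> * complex_of_real (X \<omega>)) (at 0)"
        by (simp add: has_field_derivative_iff)
      moreover have "filterlim (\<lambda>n. complex_of_real (r n)) (at 0) sequentially"
        using tendsto_of_real[OF r0, where 'a = complex] rne by (simp add: filterlim_at)
      ultimately have "(\<lambda>n. (exp (\<i> * complex_of_real (X \<omega>) * complex_of_real (r n)) - 1) / complex_of_real (r n))
          \<longlonglongrightarrow> \<i> * complex_of_real (X \<omega>)"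
        by (rule filterlim_compose)
      then have "(\<lambda>n. (iexp (r n * X \<omega>) - 1) / complex_of_real (r n)) \<longlonglongrightarrow> \<i> * complex_of_real (X \<omega>)"
        by (simp add: mult_ac)
      then show "(\<lambda>n. f n \<omega>) \<longlonglongrightarrow> \<i> * complex_of_real (X \<omega>) * iexp (S \<omega>)"
        unfolding f_def by (intro tendsto_mult tendsto_const)
    qed
  qed (auto simp: f_def)
  moreover have "(CLINT \<omega>|M. f n \<omega>) = complex_of_real ((g (r n) - g 0) / r n)" for n
  proof -
    have int: "integrable M (\<lambda>\<omega>. iexp (a * X \<omega> + S \<omega>))" for a
      by (rule integrable_iexp) auto
    have "f n = (\<lambda>\<omega>. (iexp (r n * X \<omega> + S \<omega>) - iexp (0 * X \<omega> + S \<omega>)) / complex_of_real (r n))"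
      by (simp add: f_def fun_eq_iff diff_divide_distrib left_diff_distrib distrib_left exp_add)
    then have "(CLINT \<omega>|M. f n \<omega>) = (CLINT \<omega>|M. (iexp (r n * X \<omega> + S \<omega>) - iexp (0 * X \<omega> + S \<omega>))) / complex_of_real (r n)"
      by simp
    also have "\<dots> = (complex_of_real (g (r n)) - complex_of_real (g 0)) / complex_of_real (r n)"
      by (subst Bochner_Integration.integral_diff[OF int int]) (simp only: g)
    finally show ?thesis
      by simp
  qed
  moreover have "(\<lambda>n. complex_of_real ((g (r n) - g 0) / r n)) \<longlonglongrightarrow> complex_of_real 0"
  proof (rule tendsto_of_real)
    \<comment> \<open>\<open>g\<close> depends on \<open>a\<close> only through
      \<open>a\<^sup>2\<close>, so its derivative at 0 vanishes.\<close>
    have "(g has_field_derivative 0) (at 0)"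
      unfolding g_def by (auto intro!: derivative_eq_intros)
    then have "((\<lambda>h. (g h - g 0) / h) \<longlongrightarrow> 0) (at 0)"
      by (simp add: has_field_derivative_iff)
    moreover have "filterlim r (at 0) sequentially"
      using r0 rne by (simp add: filterlim_at)
    ultimately show "(\<lambda>n. (g (r n) - g 0) / r n) \<longlonglongrightarrow> 0"
      by (rule filterlim_compose)
  qed
  ultimately have "(CLINT \<omega>|M. \<i> * complex_of_real (X \<omega>) * iexp (S \<omega>)) = 0"
    using LIMSEQ_unique by fastforce
  then show ?thesis
    by (simp add: mult.assoc)
qed

end

section \<open>Testing an integrable variable against generated events\<close>

context prob_space
begin

text \<open>Identifies the weighted integral with the Fourier transform of a positive measure on the
  line, which puts it within reach of Levy's uniqueness theorem.\<close>

lemma char_distr_density: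
  assumes f: "integrable M f" "\<And>\<omega>. 0 \<le> f \<omega>" and [measurable]: "Y \<in> borel_measurable M"
  shows "char (distr (density M (\<lambda>\<omega>. ennreal (f \<omega>))) borel Y) u
    = (CLINT \<omega>|M. complex_of_real (f \<omega>) * iexp (u * Y \<omega>))"
proof -
  have [measurable]: "f \<in> borel_measurable M"
    using f(1) by measurable
  show ?thesis
    unfolding char_def
    by (subst integral_distr) (auto simp: integral_density f(2) scaleR_conv_of_real)
qed

text \<open>Split \<open>V\<close> into its positive and negative parts. By hypothesis the laws of
  \<open>Y\<close> weighted by the two parts have the same characteristic function, so they agree on
  \<open>B\<close>.\<close>

lemma real_integral_indicator_zero_of_iexp:
  fixes V Y :: "'a \<Rightarrow> real"
  assumes V: "integrable M V" and [measurable]: "Y \<in> borel_measurable M" "B \<in> sets borel"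
    and zero: "\<And>u. (CLINT \<omega>|M. complex_of_real (V \<omega>) * iexp (u * Y \<omega>)) = 0"
  shows "expectation (\<lambda>\<omega>. V \<omega> * indicator B (Y \<omega>)) = 0"
proof -
  have [measurable]: "V \<in> borel_measurable M"
    using V by measurable
  define P where "P \<omega> = max 0 (V \<omega>)" for \<omega>
  define N where "N \<omega> = max 0 (- V \<omega>)" for \<omega>
  have VPN: "V \<omega> = P \<omega> - N \<omega>" and absV: "\<bar>V \<omega>\<bar> = P \<omega> + N \<omega>" for \<omega>
    by (auto simp: P_def N_def)
  have P: "integrable M P" "\<And>\<omega>. 0 \<le> P \<omega>" and N: "integrable M N" "\<And>\<omega>. 0 \<le> N \<omega>"
    using V by (auto simp: P_def[abs_def] N_def[abs_def])
  have [measurable]: "P \<in> borel_measurable M" "N \<in> borel_measurable M"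
    using P N by auto
  have iexp_int: "integrable M (\<lambda>\<omega>. complex_of_real (f \<omega>) * iexp (u * Y \<omega>))"
    if "integrable M f" for f u
  proof (rule Bochner_Integration.integrable_bound[OF that])
    show "(\<lambda>\<omega>. complex_of_real (f \<omega>) * iexp (u * Y \<omega>)) \<in> borel_measurable M"
      using that by measurable
  qed (simp add: norm_mult)
  have char_eq: "(CLINT \<omega>|M. complex_of_real (P \<omega>) * iexp (u * Y \<omega>))
      = (CLINT \<omega>|M. complex_of_real (N \<omega>) * iexp (u * Y \<omega>))" for u
  proof -
    have "(CLINT \<omega>|M. complex_of_real (P \<omega>) * iexp (u * Y \<omega>))
        - (CLINT \<omega>|M. complex_of_real (N \<omega>) * iexp (u * Y \<omega>))
        = (CLINT \<omega>|M. complex_of_real (V \<omega>) * iexp (u * Y \<omega>))"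
      by (subst Bochner_Integration.integral_diff[OF iexp_int iexp_int, OF P(1) N(1), symmetric])
        (simp add: VPN left_diff_distrib)
    then show ?thesis
      using zero[of u] by simp
  qed
  define m where "m = expectation P"
  \<comment> \<open>At \<open>u = 0\<close> the characteristic functions give the total
    masses.\<close>
  have mN: "expectation N = m"
    using char_eq[of 0] by (simp add: m_def)
  show ?thesis
  \<comment> \<open>Zero mass cannot be normalised, but in that case \<open>V = 0\<close> almost
    surely.\<close>
  proof (cases "m = 0")
    case True
    then have "AE \<omega> in M. P \<omega> = 0" "AE \<omega> in M. N \<omega> = 0"
      using integral_nonneg_eq_0_iff_AE[OF P(1)] integral_nonneg_eq_0_iff_AE[OF N(1)] P(2) N(2) mN
      by (auto simp: m_def)
    then have "AE \<omega> in M. V \<omega> * indicator B (Y \<omega>) = 0"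
      by eventually_elim (simp add: VPN)
    then show ?thesis
      by (rule integral_eq_zero_AE)
  next
    case False
    then have m: "m > 0"
      using P(2) by (simp add: m_def order_less_le)
    \<comment> \<open>Dividing by the common mass \<open>m\<close> yields probability measures, to
      which \<open>Levy_uniqueness\<close> applies.\<close>
    define \<mu> where "\<mu> f = distr (density M (\<lambda>\<omega>. ennreal (f \<omega> / m))) borel Y" for f
    have dist: "real_distribution (\<mu> f)"
      if f: "integrable M f" "\<And>\<omega>. 0 \<le> f \<omega>" "expectation f = m" for f
    proof -
      have [measurable]: "f \<in> borel_measurable M"
        using f by measurable
      have "(\<integral>\<^sup>+\<omega>. ennreal (f \<omega> / m) \<partial>M) = ennreal (expectation (\<lambda>\<omega>. f \<omega> / m))"
        using f m by (intro nn_integral_eq_integral) auto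
      also have "\<dots> = 1"
        using f m by simp
      finally have "prob_space (density M (\<lambda>\<omega>. ennreal (f \<omega> / m)))"
        by (intro prob_spaceI) (simp add: emeasure_density cong: nn_integral_cong)
      then interpret D: prob_space "density M (\<lambda>\<omega>. ennreal (f \<omega> / m))" .
      show ?thesis
        unfolding \<mu>_def by (rule D.real_distribution_distr) simp
    qed
    have "char (\<mu> P) = char (\<mu> N)"
    proof
      fix u
      have "char (\<mu> f) u = (CLINT \<omega>|M. complex_of_real (f \<omega>) * iexp (u * Y \<omega>)) / complex_of_real m"
        if "integrable M f" "\<And>\<omega>. 0 \<le> f \<omega>" for f
        unfolding \<mu>_def using that m by (subst char_distr_density) auto
      then show "char (\<mu> P) u = char (\<mu> N) u"
        using P N char_eq[of u] by simp
    qed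
    then have "\<mu> P = \<mu> N"
      using P N mN by (intro Levy_uniqueness dist) (auto simp: m_def)
    then have "measure (\<mu> P) B = measure (\<mu> N) B"
      by simp
    moreover have "measure (\<mu> f) B = expectation (\<lambda>\<omega>. f \<omega> * indicator B (Y \<omega>)) / m"
      if f: "integrable M f" "\<And>\<omega>. 0 \<le> f \<omega>" for f
    proof -
      have [measurable]: "f \<in> borel_measurable M"
        using f by measurable
      have "measure (\<mu> f) B = (LINT x|\<mu> f. indicator B x)"
        by (simp add: \<mu>_def)
      also have "\<dots> = expectation (\<lambda>\<omega>. (f \<omega> / m) * indicator B (Y \<omega>))"
        unfolding \<mu>_def using f(2) m
        by (subst integral_distr) (auto simp: integral_density)
      finally show ?thesis
        by simp
    qed
    ultimately have eq: "expectation (\<lambda>\<omega>. P \<omega> * indicator B (Y \<omega>)) = expectation (\<lambda>\<omega>. N \<omega> * indicator B (Y \<omega>))"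
      using P N m by simp
    have ind_int: "integrable M (\<lambda>\<omega>. f \<omega> * indicator B (Y \<omega>))" if "integrable M f" for f :: "'a \<Rightarrow> real"
    proof (rule Bochner_Integration.integrable_bound[OF that])
      show "(\<lambda>\<omega>. f \<omega> * indicator B (Y \<omega>)) \<in> borel_measurable M"
        using that by measurable
    qed (simp add: indicator_def)
    show ?thesis
      using eq by (simp add: VPN left_diff_distrib Bochner_Integration.integral_diff ind_int P N)
  qed
qed

text \<open>The induction over coordinates below produces complex weights. Conjugation at
  \<open>- u\<close> gives the hypothesis for \<open>cnj V\<close> too, hence for the real and
  imaginary parts, where the real case applies.\<close>

lemma complex_integral_indicator_zero_of_iexp:
  fixes V :: "'a \<Rightarrow> complex"
  assumes V: "integrable M V" and Y[measurable]: "Y \<in> borel_measurable M" and B[measurable]: "B \<in> sets borel"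
    and zero: "\<And>u. (CLINT \<omega>|M. V \<omega> * iexp (u * Y \<omega>)) = 0"
  shows "(CLINT \<omega>|M. V \<omega> * indicator B (Y \<omega>)) = 0"
proof -
  have int: "integrable M (\<lambda>\<omega>. W \<omega> * iexp (u * Y \<omega>))" if "integrable M W" for W u
  proof (rule Bochner_Integration.integrable_bound[OF that])
    show "(\<lambda>\<omega>. W \<omega> * iexp (u * Y \<omega>)) \<in> borel_measurable M"
      using that by measurable
  qed (simp add: norm_mult)
  have zero': "(CLINT \<omega>|M. cnj (V \<omega>) * iexp (u * Y \<omega>)) = 0" for u
  proof -
    have "cnj (V \<omega> * iexp (- u * Y \<omega>)) = cnj (V \<omega>) * iexp (u * Y \<omega>)" for \<omega>
      by (simp add: exp_cnj)
    then have "(CLINT \<omega>|M. cnj (V \<omega>) * iexp (u * Y \<omega>)) = (CLINT \<omega>|M. cnj (V \<omega> * iexp (- u * Y \<omega>)))"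
      by (simp only:)
    also have "\<dots> = cnj (CLINT \<omega>|M. V \<omega> * iexp (- u * Y \<omega>))"
      by (rule Bochner_Integration.integral_cnj)
    finally show ?thesis
      by (simp only: zero complex_cnj_zero)
  qed
  have cV: "integrable M (\<lambda>\<omega>. cnj (V \<omega>))"
    using V by simp
  have re: "complex_of_real (Re z) = (z + cnj z) / 2" and im: "complex_of_real (Im z) = (z - cnj z) / (2 * \<i>)"
    for z
    by (auto simp: complex_eq_iff)
  have eqs: "(CLINT \<omega>|M. complex_of_real (Re (V \<omega>)) * iexp (u * Y \<omega>))
        = (CLINT \<omega>|M. (V \<omega> * iexp (u * Y \<omega>) + cnj (V \<omega>) * iexp (u * Y \<omega>)) / 2)"
      "(CLINT \<omega>|M. complex_of_real (Im (V \<omega>)) * iexp (u * Y \<omega>))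
        = (CLINT \<omega>|M. (V \<omega> * iexp (u * Y \<omega>) - cnj (V \<omega>) * iexp (u * Y \<omega>)) / (2 * \<i>))" for u
    by (simp_all only: re im distrib_right left_diff_distrib times_divide_eq_left)
  have ReIm: "(CLINT \<omega>|M. complex_of_real (Re (V \<omega>)) * iexp (u * Y \<omega>)) = 0"
      "(CLINT \<omega>|M. complex_of_real (Im (V \<omega>)) * iexp (u * Y \<omega>)) = 0" for u
    unfolding eqs integral_divide_zero
      Bochner_Integration.integral_add[OF int[OF V] int[OF cV]]
      Bochner_Integration.integral_diff[OF int[OF V] int[OF cV]] zero zero' by simp_all
  have ind_int: "integrable M (\<lambda>\<omega>. V \<omega> * indicator B (Y \<omega>))"
  proof (rule Bochner_Integration.integrable_bound[OF V])
    show "(\<lambda>\<omega>. V \<omega> * indicator B (Y \<omega>)) \<in> borel_measurable M"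
      using V by measurable
  qed (simp add: indicator_def)
  have "Re (CLINT \<omega>|M. V \<omega> * indicator B (Y \<omega>)) = expectation (\<lambda>\<omega>. Re (V \<omega>) * indicator B (Y \<omega>))"
    by (subst integral_Re[OF ind_int, symmetric]) (auto intro!: Bochner_Integration.integral_cong simp: indicator_def)
  moreover have "Im (CLINT \<omega>|M. V \<omega> * indicator B (Y \<omega>)) = expectation (\<lambda>\<omega>. Im (V \<omega>) * indicator B (Y \<omega>))"
    by (subst integral_Im[OF ind_int, symmetric]) (auto intro!: Bochner_Integration.integral_cong simp: indicator_def)
  ultimately show ?thesis
    using real_integral_indicator_zero_of_iexp[OF integrable_Re[OF V] Y B ReIm(1)]
      real_integral_indicator_zero_of_iexp[OF integrable_Im[OF V] Y B ReIm(2)]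
    by (simp add: complex_eq_iff)
qed

text \<open>One coordinate at a time, the exponential is traded for an indicator; this replaces the
  uniqueness theorem for multivariate characteristic functions.\<close>

lemma integral_prod_indicator_zero_of_iexp:
  fixes V :: "'a \<Rightarrow> complex"
  assumes "finite J" and "integrable M V"
    and "\<And>j. j \<in> J \<Longrightarrow> Y j \<in> borel_measurable M" "\<And>j. j \<in> J \<Longrightarrow> B j \<in> sets borel"
    and "\<And>u. (CLINT \<omega>|M. V \<omega> * iexp (lin_comb Y J u \<omega>)) = 0"
  shows "(CLINT \<omega>|M. V \<omega> * (\<Prod>j\<in>J. indicator (B j) (Y j \<omega>))) = 0"
  using assms
proof (induction J arbitrary: V rule: finite_induct)
  case empty
  then show ?case
    by (simp add: lin_comb_def)
next
  case (insert k J)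
  have [measurable]: "Y k \<in> borel_measurable M" "B k \<in> sets borel" "V \<in> borel_measurable M"
    using insert.prems by auto
  have [measurable]: "lin_comb Y J u \<in> borel_measurable M" for u
    unfolding lin_comb_def using insert.prems by measurable
  let ?W = "\<lambda>\<omega>. V \<omega> * indicator (B k) (Y k \<omega>)"
  have "(CLINT \<omega>|M. ?W \<omega> * (\<Prod>j\<in>J. indicator (B j) (Y j \<omega>))) = 0"
  proof (rule insert.IH)
    show "integrable M ?W"
      by (rule Bochner_Integration.integrable_bound[OF insert.prems(1)]) (auto simp: indicator_def)
    fix u
    \<comment> \<open>Coordinate \<open>k\<close> is treated with the exponential of the remaining
      coordinates absorbed into the weight.\<close>
    have "(CLINT \<omega>|M. (V \<omega> * iexp (lin_comb Y J u \<omega>)) * indicator (B k) (Y k \<omega>)) = 0"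
    proof (rule complex_integral_indicator_zero_of_iexp)
      show "integrable M (\<lambda>\<omega>. V \<omega> * iexp (lin_comb Y J u \<omega>))"
        by (rule Bochner_Integration.integrable_bound[OF insert.prems(1)]) (auto simp: norm_mult)
      fix s
      \<comment> \<open>Since \<open>k\<close> is not in \<open>J\<close>, the frequency
        \<open>u(k := s)\<close> splits the joint exponential into the two factors needed.\<close>
      have "lin_comb Y (insert k J) (u(k := s)) \<omega> = lin_comb Y J u \<omega> + s * Y k \<omega>" for \<omega>
        using insert.hyps by (auto simp: lin_comb_def intro!: sum.cong)
      then show "(CLINT \<omega>|M. V \<omega> * iexp (lin_comb Y J u \<omega>) * iexp (s * Y k \<omega>)) = 0"
        using insert.prems(4)[of "u(k := s)"] by (simp add: distrib_left exp_add mult.assoc del: fun_upd_apply)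
    qed auto
    then show "(CLINT \<omega>|M. ?W \<omega> * iexp (lin_comb Y J u \<omega>)) = 0"
      by (simp add: mult_ac)
  qed (use insert.prems in auto)
  then show ?case
    using insert.hyps by (simp add: mult_ac)
qed

text \<open>The events over which \<open>f\<close> integrates to zero form a Dynkin system; mean
  zero is what closes it under complements.\<close>

lemma integral_indicator_zero_Dynkin:
  fixes f :: "'a \<Rightarrow> real"
  assumes f: "integrable M f" "expectation f = 0"
    and E: "Int_stable E" "E \<subseteq> sets M" "\<And>A. A \<in> E \<Longrightarrow> expectation (\<lambda>\<omega>. f \<omega> * indicator A \<omega>) = 0"
    and A: "A \<in> sigma_sets (space M) E"
  shows "expectation (\<lambda>\<omega>. f \<omega> * indicator A \<omega>) = 0"
proof -
  have ind_int: "integrable M (\<lambda>\<omega>. f \<omega> * indicator A \<omega>)" if "A \<in> sets M" for A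
    using integrable_mult_indicator[OF that f(1)] by (simp add: mult.commute)
  have sub: "sigma_sets (space M) E \<subseteq> sets M"
    using E(2) by (rule sets.sigma_sets_subset)
  have Pow: "E \<subseteq> Pow (space M)"
    using E(2) sets.space_closed by blast
  show ?thesis
    using E(1) Pow A
  proof (induction rule: sigma_sets_induct_disjoint)
    case (basic A)
    then show ?case by (rule E(3))
  next
    case empty
    then show ?case by simp
  next
    case (compl A)
    then have AM: "A \<in> sets M"
      using sub by auto
    have "expectation (\<lambda>\<omega>. f \<omega> * indicator (space M - A) \<omega>)
        = expectation (\<lambda>\<omega>. f \<omega> - f \<omega> * indicator A \<omega>)"
      by (intro Bochner_Integration.integral_cong) (auto simp: indicator_def)
    then show ?case
      using compl f ind_int[OF AM] by simp
  next
    case (union A)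
    then have AM: "A i \<in> sets M" for i
      using sub by auto
    have "(LINT \<omega>:(\<Union>i. A i)|M. f \<omega>) = (\<Sum>i. LINT \<omega>:A i|M. f \<omega>)"
    proof (rule lebesgue_integral_countable_add)
      show "A i \<inter> A j = {}" if "i \<noteq> j" for i j
        using union(1) that by (auto simp: disjoint_family_on_def)
      show "set_integrable M (\<Union>i. A i) f"
        unfolding set_integrable_def using AM f(1) by (intro integrable_mult_indicator) auto
    qed (use AM in auto)
    then show ?case
      using union by (simp add: set_lebesgue_integral_def mult.commute)
  qed
qed

section \<open>Generated sigma-fields and their generators\<close>

lemma space_sigma_family [simp]: "space (sigma_family M Y J) = space M"
  by (simp add: sigma_family_def space_measure_of_conv)

lemma sets_sigma_rv: "sets (sigma_rv M Y) = {Y -` B \<inter> space M | B. B \<in> sets borel}"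
  unfolding sigma_rv_def by (rule sets_vimage_algebra2) simp

lemma sets_sigma_family:
  "sets (sigma_family M Y J) = sigma_sets (space M) (\<Union>j\<in>J. sets (sigma_rv M (Y j)))"
  unfolding sigma_family_def by (rule sets_measure_of) (auto simp: sets_sigma_rv)

text \<open>Provides an intersection-stable generator for the Dynkin argument. Finiteness of
  \<open>J\<close> makes a box a finite intersection of one-coordinate events.\<close>

lemma sigma_family_eq_sigma_sets_boxes:
  "sets (sigma_family M Y J) =
    sigma_sets (space M) {{\<omega>\<in>space M. \<forall>j\<in>J. Y j \<omega> \<in> B j} | B. \<forall>j\<in>J. B j \<in> sets borel}"
  if "finite J"
proof -
  let ?E = "{{\<omega>\<in>space M. \<forall>j\<in>J. Y j \<omega> \<in> B j} | B. \<forall>j\<in>J. B j \<in> sets (borel :: real measure)}"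
  have "sigma_sets (space M) (\<Union>j\<in>J. sets (sigma_rv M (Y j))) = sigma_sets (space M) ?E"
  proof (rule sigma_sets_eqI)
    fix A assume "A \<in> (\<Union>j\<in>J. sets (sigma_rv M (Y j)))"
    then obtain j B where j: "j \<in> J" and B: "B \<in> sets borel" and A: "A = Y j -` B \<inter> space M"
      by (auto simp: sets_sigma_rv)
    \<comment> \<open>An event of a single coordinate is a box with \<open>UNIV\<close> in all other
      coordinates.\<close>
    have "A = {\<omega>\<in>space M. \<forall>i\<in>J. Y i \<omega> \<in> (if i = j then B else UNIV)}"
      using j by (auto simp: A)
    then have "A \<in> ?E"
      using B by (auto intro!: exI[of _ "\<lambda>i. if i = j then B else UNIV"])
    then show "A \<in> sigma_sets (space M) ?E"
      by (rule sigma_sets.Basic)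
  next
    fix A assume "A \<in> ?E"
    then obtain B where B: "\<And>j. j \<in> J \<Longrightarrow> B j \<in> sets borel" and A: "A = {\<omega>\<in>space M. \<forall>j\<in>J. Y j \<omega> \<in> B j}"
      by auto
    have "{\<omega>\<in>space (sigma_family M Y J). \<forall>j\<in>J. Y j \<omega> \<in> B j} \<in> sets (sigma_family M Y J)"
    proof (rule sets.sets_Collect_finite_All)
      fix j assume j: "j \<in> J"
      have "{\<omega>\<in>space M. Y j \<omega> \<in> B j} = Y j -` B j \<inter> space M"
        by auto
      also have "\<dots> \<in> (\<Union>j\<in>J. sets (sigma_rv M (Y j)))"
        using j B[OF j] by (auto simp: sets_sigma_rv)
      finally show "{\<omega>\<in>space (sigma_family M Y J). Y j \<omega> \<in> B j} \<in> sets (sigma_family M Y J)"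
        by (simp add: sets_sigma_family sigma_sets.Basic)
    qed (fact that)
    then show "A \<in> sigma_sets (space M) (\<Union>j\<in>J. sets (sigma_rv M (Y j)))"
      by (simp add: sets_sigma_family A)
  qed
  then show ?thesis
    by (simp add: sets_sigma_family)
qed

end

section \<open>Conditioning in the first chaos\<close>

context prob_space
begin

lemma subalgebra_sigma_family:
  assumes "\<And>j. j \<in> J \<Longrightarrow> Y j \<in> borel_measurable M"
  shows "subalgebra M (sigma_family M Y J)"
proof -
  have "sets (sigma_rv M (Y j)) \<subseteq> sets M" if "j \<in> J" for j
    using assms[OF that] by (auto simp: sets_sigma_rv)
  then have "sigma_sets (space M) (\<Union>j\<in>J. sets (sigma_rv M (Y j))) \<subseteq> sets M"
    by (intro sets.sigma_sets_subset) auto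
  then show ?thesis
    by (simp add: subalgebra_def sets_sigma_family)
qed

lemma measurable_sigma_family:
  assumes "j \<in> J"
  shows "Y j \<in> borel_measurable (sigma_family M Y J)"
proof (rule measurableI)
  fix B :: "real set" assume "B \<in> sets borel"
  then have "Y j -` B \<inter> space M \<in> (\<Union>j\<in>J. sets (sigma_rv M (Y j)))"
    using assms by (auto simp: sets_sigma_rv)
  then show "Y j -` B \<inter> space (sigma_family M Y J) \<in> sets (sigma_family M Y J)"
    by (simp add: sets_sigma_family sigma_sets.Basic)
qed simp

lemma lin_comb_measurable_sigma_family:
  "J' \<subseteq> J \<Longrightarrow> lin_comb Y J' c \<in> borel_measurable (sigma_family M Y J)"
  unfolding lin_comb_def
  by (intro borel_measurable_sum borel_measurable_times borel_measurable_const measurable_sigma_family) auto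

lemma sigma_family_mono: "J \<subseteq> K \<Longrightarrow> sets (sigma_family M Y J) \<subseteq> sets (sigma_family M Y K)"
  unfolding sets_sigma_family by (intro sigma_sets_mono') auto

lemma subalgebra_sigma_rv:
  assumes "subalgebra M G" "X \<in> borel_measurable G"
  shows "subalgebra G (sigma_rv M X)"
  unfolding subalgebra_def
proof
  show "space (sigma_rv M X) = space G"
    using assms by (simp add: sigma_rv_def subalgebra_def)
  show "sets (sigma_rv M X) \<subseteq> sets G"
    using assms measurable_sets[OF assms(2)] by (auto simp: sets_sigma_rv subalgebra_def)
qed

text \<open>Lets results on finite families be applied to a single variable; the index is
  arbitrary.\<close>

lemma sets_sigma_family_singleton: "sets (sigma_family M (\<lambda>_. X) {i}) = sets (sigma_rv M X)"
proof -
  have sp: "space (sigma_rv M X) = space M"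
    by (simp add: sigma_rv_def)
  show ?thesis
    using sets.sigma_sets_eq[of "sigma_rv M X"] by (simp add: sets_sigma_family sp)
qed

text \<open>For passing from \<open>sigma_rv\<close> to a one-element \<open>sigma_family\<close>:
  the two are built differently but have the same events.\<close>

lemma real_cond_exp_cong_sets:
  assumes "space F = space G" "sets F = sets G"
  shows "real_cond_exp M F = real_cond_exp M G"
  using assms unfolding real_cond_exp_def[abs_def] nn_cond_exp_def[abs_def] restr_to_subalg_def subalgebra_def
  by (auto cong: measurable_cong_sets)

lemma finite_measure_subalgebraI: "subalgebra M G \<Longrightarrow> finite_measure_subalgebra M G"
  by unfold_locales

end

section \<open>The first chaos as a Gaussian linear space\<close>

locale centered_gaussian_space = prob_space M for M :: "'a measure" +
  fixes T :: real and Z :: "real \<Rightarrow> 'a \<Rightarrow> real"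
  assumes Z_L2: "\<And>s. s \<in> {0..T} \<Longrightarrow> Z s \<in> L2_space M"
    and Z_gaussian: "centered_gaussian_process M T Z"
begin

abbreviation chaos :: "('a \<Rightarrow> real) set" where
  "chaos \<equiv> first_chaos M T Z"

lemma chaos_L2: "X \<in> chaos \<Longrightarrow> X \<in> L2_space M"
  by (simp add: first_chaos_def)

lemma chaos_approx:
  assumes "X \<in> chaos" "e > 0"
  obtains S c where "finite S" "S \<subseteq> {0..T}" "expectation (\<lambda>\<omega>. (X \<omega> - (\<Sum>s\<in>S. c s * Z s \<omega>))\<^sup>2) < e"
  using assms by (auto simp: first_chaos_def)

lemma chaosI:
  assumes "X \<in> L2_space M"
    and "\<And>e. e > 0 \<Longrightarrow> \<exists>S c. finite S \<and> S \<subseteq> {0..T} \<and>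
      expectation (\<lambda>\<omega>. (X \<omega> - (\<Sum>s\<in>S. c s * Z s \<omega>))\<^sup>2) < e"
  shows "X \<in> chaos"
  using assms by (simp add: first_chaos_def)

lemma Z_chaos: "s \<in> {0..T} \<Longrightarrow> Z s \<in> chaos"
  unfolding first_chaos_def by (auto simp: Z_L2 intro!: exI[of _ "{s}"] exI[of _ "\<lambda>_. 1"])

lemma chaos_scale:
  assumes X: "X \<in> chaos"
  shows "(\<lambda>\<omega>. a * X \<omega>) \<in> chaos"
proof (rule chaosI)
  show "(\<lambda>\<omega>. a * X \<omega>) \<in> L2_space M"
    using X by (intro L2_space_scale chaos_L2)
  fix e :: real assume e: "e > 0"
  \<comment> \<open>The summand 1 keeps the denominator positive when \<open>a = 0\<close> and makes
    \<open>a\<^sup>2 * e' < e\<close> strict.\<close>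
  define e' where "e' = e / (a\<^sup>2 + 1)"
  have pos: "a\<^sup>2 + 1 > 0"
    by (simp add: add_nonneg_pos)
  have "e' > 0"
    using e pos by (simp add: e'_def)
  with X obtain S c where S: "finite S" "S \<subseteq> {0..T}"
    and lt: "expectation (\<lambda>\<omega>. (X \<omega> - (\<Sum>s\<in>S. c s * Z s \<omega>))\<^sup>2) < e'"
    by (rule chaos_approx)
  have "expectation (\<lambda>\<omega>. (a * X \<omega> - (\<Sum>s\<in>S. a * c s * Z s \<omega>))\<^sup>2)
      = expectation (\<lambda>\<omega>. a\<^sup>2 * (X \<omega> - (\<Sum>s\<in>S. c s * Z s \<omega>))\<^sup>2)"
    by (simp add: mult.assoc right_diff_distrib flip: sum_distrib_left power_mult_distrib)
  also have "\<dots> \<le> a\<^sup>2 * e'"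
    using lt by (simp add: mult_left_mono)
  also have "\<dots> < e"
    using pos e by (simp add: e'_def divide_less_eq algebra_simps)
  finally show "\<exists>S c. finite S \<and> S \<subseteq> {0..T} \<and> expectation (\<lambda>\<omega>. (a * X \<omega> - (\<Sum>s\<in>S. c s * Z s \<omega>))\<^sup>2) < e"
    using S by (intro exI[of _ S] exI[of _ "\<lambda>s. a * c s"]) simp
qed

lemma chaos_add:
  assumes X: "X \<in> chaos" and Y: "Y \<in> chaos"
  shows "(\<lambda>\<omega>. X \<omega> + Y \<omega>) \<in> chaos"
proof (rule chaosI)
  show "(\<lambda>\<omega>. X \<omega> + Y \<omega>) \<in> L2_space M"
    using X Y by (intro L2_space_add chaos_L2)
  fix e :: real assume "e > 0"
  \<comment> \<open>By \<open>(p + q)\<^sup>2 \<le> 2 * p\<^sup>2 + 2 * q\<^sup>2\<close>, two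
    errors below \<open>e / 4\<close> combine to less than \<open>e\<close>.\<close>
  then have "e / 4 > 0"
    by simp
  obtain S c where S: "finite S" "S \<subseteq> {0..T}"
    and lt: "expectation (\<lambda>\<omega>. (X \<omega> - (\<Sum>s\<in>S. c s * Z s \<omega>))\<^sup>2) < e / 4"
    using X \<open>e / 4 > 0\<close> by (rule chaos_approx)
  obtain S' c' where S': "finite S'" "S' \<subseteq> {0..T}"
    and lt': "expectation (\<lambda>\<omega>. (Y \<omega> - (\<Sum>s\<in>S'. c' s * Z s \<omega>))\<^sup>2) < e / 4"
    using Y \<open>e / 4 > 0\<close> by (rule chaos_approx)
  \<comment> \<open>The coefficients are extended by 0 so that both sums can run over
    \<open>S \<union> S'\<close>.\<close>
  define d where "d s = (if s \<in> S then c s else 0) + (if s \<in> S' then c' s else 0)" for s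
  have sum_d: "(\<Sum>s\<in>S \<union> S'. d s * Z s \<omega>) = (\<Sum>s\<in>S. c s * Z s \<omega>) + (\<Sum>s\<in>S'. c' s * Z s \<omega>)" for \<omega>
  proof -
    have "(\<Sum>s\<in>S \<union> S'. d s * Z s \<omega>) = (\<Sum>s\<in>S \<union> S'. (if s \<in> S then c s * Z s \<omega> else 0))
        + (\<Sum>s\<in>S \<union> S'. (if s \<in> S' then c' s * Z s \<omega> else 0))"
      unfolding sum.distrib[symmetric] by (intro sum.cong) (auto simp: d_def distrib_right)
    also have "\<dots> = (\<Sum>s\<in>(S \<union> S') \<inter> S. c s * Z s \<omega>) + (\<Sum>s\<in>(S \<union> S') \<inter> S'. c' s * Z s \<omega>)"
      using S(1) S'(1) by (simp only: sum.inter_restrict finite_Un)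
    also have "\<dots> = (\<Sum>s\<in>S. c s * Z s \<omega>) + (\<Sum>s\<in>S'. c' s * Z s \<omega>)"
      by (simp add: Int_absorb1)
    finally show ?thesis .
  qed
  let ?P = "\<lambda>\<omega>. X \<omega> - (\<Sum>s\<in>S. c s * Z s \<omega>)" and ?Q = "\<lambda>\<omega>. Y \<omega> - (\<Sum>s\<in>S'. c' s * Z s \<omega>)"
  have P: "?P \<in> L2_space M"
    using S by (intro L2_space_diff L2_space_sum L2_space_scale chaos_L2[OF X] Z_L2) auto
  have Q: "?Q \<in> L2_space M"
    using S' by (intro L2_space_diff L2_space_sum L2_space_scale chaos_L2[OF Y] Z_L2) auto
  have "expectation (\<lambda>\<omega>. (X \<omega> + Y \<omega> - (\<Sum>s\<in>S \<union> S'. d s * Z s \<omega>))\<^sup>2)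
      \<le> expectation (\<lambda>\<omega>. 2 * (?P \<omega>)\<^sup>2 + 2 * (?Q \<omega>)\<^sup>2)"
  proof (rule integral_mono)
    have "X \<omega> + Y \<omega> - (\<Sum>s\<in>S \<union> S'. d s * Z s \<omega>) = ?P \<omega> + ?Q \<omega>" for \<omega>
      by (simp add: sum_d)
    then show "integrable M (\<lambda>\<omega>. (X \<omega> + Y \<omega> - (\<Sum>s\<in>S \<union> S'. d s * Z s \<omega>))\<^sup>2)"
      using L2_space_square_integrable[OF L2_space_add[OF P Q]] by (simp only:)
    show "integrable M (\<lambda>\<omega>. 2 * (?P \<omega>)\<^sup>2 + 2 * (?Q \<omega>)\<^sup>2)"
      using L2_space_square_integrable[OF P] L2_space_square_integrable[OF Q] by simp
    have "(p + q)\<^sup>2 \<le> 2 * p\<^sup>2 + 2 * q\<^sup>2" for p q :: real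
      using zero_le_power2[of "p - q"] by (simp add: power2_eq_square algebra_simps)
    from this[of "?P _" "?Q _"]
    show "(X \<omega> + Y \<omega> - (\<Sum>s\<in>S \<union> S'. d s * Z s \<omega>))\<^sup>2 \<le> 2 * (?P \<omega>)\<^sup>2 + 2 * (?Q \<omega>)\<^sup>2" for \<omega>
      by (simp add: sum_d algebra_simps)
  qed
  also have "\<dots> = 2 * expectation (\<lambda>\<omega>. (?P \<omega>)\<^sup>2) + 2 * expectation (\<lambda>\<omega>. (?Q \<omega>)\<^sup>2)"
    using L2_space_square_integrable[OF P] L2_space_square_integrable[OF Q] by simp
  also have "\<dots> < e"
    using lt lt' by simp
  finally show "\<exists>S c. finite S \<and> S \<subseteq> {0..T} \<and>
      expectation (\<lambda>\<omega>. (X \<omega> + Y \<omega> - (\<Sum>s\<in>S. c s * Z s \<omega>))\<^sup>2) < e"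
    using S S' by (intro exI[of _ "S \<union> S'"] exI[of _ d]) simp
qed

lemma chaos_zero: "(\<lambda>\<omega>. 0) \<in> chaos"
  unfolding first_chaos_def by (auto simp: L2_space_zero intro!: exI[of _ "{}"])

lemma chaos_lin_comb:
  assumes "\<And>j. j \<in> J \<Longrightarrow> Y j \<in> chaos"
  shows "lin_comb Y J c \<in> chaos"
  unfolding lin_comb_def using assms
proof (induction J rule: infinite_finite_induct)
  case (insert k J)
  then show ?case
    using chaos_add[OF chaos_scale[of "Y k" "c k"], of "\<lambda>\<omega>. \<Sum>j\<in>J. c j * Y j \<omega>"] by simp
qed (simp_all add: chaos_zero)

lemma chaos_diff:
  assumes "X \<in> chaos" "Y \<in> chaos"
  shows "(\<lambda>\<omega>. X \<omega> - Y \<omega>) \<in> chaos"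
  using chaos_add[OF assms(1) chaos_scale[OF assms(2), of "-1"]] by simp

lemma diff_quot_chaos:
  assumes "t \<in> {0..T}" "t + h \<in> {0..T}"
  shows "diff_quot Z t h \<in> chaos"
  using chaos_scale[OF chaos_diff[OF Z_chaos[OF assms(2)] Z_chaos[OF assms(1)]], of "1 / h"]
  by (simp add: diff_quot_def)

text \<open>Finite combinations of the \<open>Z s\<close> are Gaussian by hypothesis, and elements
  of the chaos are L2 limits of them. As the chaos is a linear space, this also gives joint
  normality of finitely many elements.\<close>

lemma chaos_centered_gaussian_char:
  assumes X: "X \<in> chaos"
  shows "centered_gaussian_char X"
proof (rule centered_gaussian_char_L2_limit)
  show "X \<in> L2_space M"
    using X by (rule chaos_L2)
  fix e :: real assume "e > 0"
  with X obtain S c where S: "finite S" "S \<subseteq> {0..T}"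
    and lt: "expectation (\<lambda>\<omega>. (X \<omega> - (\<Sum>s\<in>S. c s * Z s \<omega>))\<^sup>2) < e"
    by (rule chaos_approx)
  have Zc: "(\<lambda>\<omega>. c s * Z s \<omega>) \<in> L2_space M" if "s \<in> S" for s
    using S that by (auto intro!: L2_space_scale Z_L2)
  have "centered_gaussian_char (\<lambda>\<omega>. \<Sum>s\<in>S. c s * Z s \<omega>)"
  proof (rule gaussian_rv_centered_char)
    show "(\<lambda>\<omega>. \<Sum>s\<in>S. c s * Z s \<omega>) \<in> L2_space M"
      using Zc by (intro L2_space_sum) auto
    show "gaussian_rv M (\<lambda>\<omega>. \<Sum>s\<in>S. c s * Z s \<omega>)"
      using Z_gaussian S by (simp add: centered_gaussian_process_def)
    have "expectation (\<lambda>\<omega>. \<Sum>s\<in>S. c s * Z s \<omega>) = (\<Sum>s\<in>S. c s * expectation (Z s))"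
      using Zc L2_space_integrable[OF Zc] by (subst Bochner_Integration.integral_sum) auto
    also have "\<dots> = 0"
      using Z_gaussian S by (intro sum.neutral) (auto simp: centered_gaussian_process_def)
    finally show "expectation (\<lambda>\<omega>. \<Sum>s\<in>S. c s * Z s \<omega>) = 0" .
  qed
  with lt show "\<exists>W. centered_gaussian_char W \<and> expectation (\<lambda>\<omega>. (X \<omega> - W \<omega>)\<^sup>2) < e"
    by blast
qed

text \<open>For jointly Gaussian variables orthogonality acts like independence. \<open>X\<close>
  integrates to zero against the exponentials \<open>iexp (lin_comb Y J u)\<close>, then over boxes,
  and finally over all events of the field by the Dynkin argument.\<close>

lemma chaos_orthogonal_integral_zero:
  assumes X: "X \<in> chaos" and J: "finite J" and Y: "\<And>j. j \<in> J \<Longrightarrow> Y j \<in> chaos"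
    and orth: "\<And>j. j \<in> J \<Longrightarrow> expectation (\<lambda>\<omega>. X \<omega> * Y j \<omega>) = 0"
    and A: "A \<in> sets (sigma_family M Y J)"
  shows "expectation (\<lambda>\<omega>. X \<omega> * indicator A \<omega>) = 0"
proof -
  have [measurable]: "Y j \<in> borel_measurable M" if "j \<in> J" for j
    using chaos_L2[OF Y[OF that]] by auto
  have char: "(CLINT \<omega>|M. complex_of_real (X \<omega>) * iexp (lin_comb Y J u \<omega>)) = 0" for u
  proof (rule integral_mult_iexp_orthogonal)
    show "X \<in> L2_space M" "lin_comb Y J u \<in> L2_space M"
      using X Y by (auto intro: chaos_L2 chaos_lin_comb)
    show "centered_gaussian_char (\<lambda>\<omega>. a * X \<omega> + lin_comb Y J u \<omega>)" for a
      by (intro chaos_centered_gaussian_char chaos_add chaos_scale chaos_lin_comb X Y)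
    show "expectation (\<lambda>\<omega>. X \<omega> * lin_comb Y J u \<omega>) = 0"
      using X Y orth by (subst expectation_mult_lin_comb) (auto intro: chaos_L2)
  qed
  have box: "expectation (\<lambda>\<omega>. X \<omega> * indicator {\<omega>\<in>space M. \<forall>j\<in>J. Y j \<omega> \<in> B j} \<omega>) = 0"
    if B: "\<And>j. j \<in> J \<Longrightarrow> B j \<in> sets borel" for B
  proof -
    have "(CLINT \<omega>|M. complex_of_real (X \<omega>) * (\<Prod>j\<in>J. indicator (B j) (Y j \<omega>))) = 0"
      using chaos_L2[OF X] B
      by (intro integral_prod_indicator_zero_of_iexp J char) (auto simp: L2_space_integrable)
    also have "(CLINT \<omega>|M. complex_of_real (X \<omega>) * (\<Prod>j\<in>J. indicator (B j) (Y j \<omega>)))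
      = (CLINT \<omega>|M. complex_of_real (X \<omega> * indicator {\<omega>\<in>space M. \<forall>j\<in>J. Y j \<omega> \<in> B j} \<omega>))"
    proof (intro Bochner_Integration.integral_cong refl)
      fix \<omega> assume "\<omega> \<in> space M"
      then have "(\<Prod>j\<in>J. indicator (B j) (Y j \<omega>)) =
          (indicator {\<omega>\<in>space M. \<forall>j\<in>J. Y j \<omega> \<in> B j} \<omega> :: complex)"
        using J by (auto simp: indicator_def intro!: prod_zero)
      then show "complex_of_real (X \<omega>) * (\<Prod>j\<in>J. indicator (B j) (Y j \<omega>)) =
          complex_of_real (X \<omega> * indicator {\<omega>\<in>space M. \<forall>j\<in>J. Y j \<omega> \<in> B j} \<omega>)"
        by (simp add: indicator_def)
    qed
    finally show ?thesis
      by (simp only: integral_complex_of_real of_real_eq_0_iff)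
  qed
  show ?thesis
  proof (rule integral_indicator_zero_Dynkin)
    let ?E = "{{\<omega>\<in>space M. \<forall>j\<in>J. Y j \<omega> \<in> B j} | B. \<forall>j\<in>J. B j \<in> sets (borel :: real measure)}"
    show "integrable M X"
      using X by (intro L2_space_integrable chaos_L2)
    \<comment> \<open>The box with all sides \<open>UNIV\<close> is the whole space, which gives
      mean zero.\<close>
    have "expectation (\<lambda>\<omega>. X \<omega> * indicator (space M) \<omega>) = 0"
      using box[of "\<lambda>_. UNIV"] by simp
    moreover have "expectation (\<lambda>\<omega>. X \<omega> * indicator (space M) \<omega>) = expectation X"
      by (intro Bochner_Integration.integral_cong) auto
    ultimately show "expectation X = 0"
      by simp
    show "Int_stable ?E"
    proof (rule Int_stableI)
      fix A A' assume "A \<in> ?E" "A' \<in> ?E"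
      then obtain B B' where "\<forall>j\<in>J. B j \<in> sets borel" "\<forall>j\<in>J. B' j \<in> sets borel"
        "A = {\<omega>\<in>space M. \<forall>j\<in>J. Y j \<omega> \<in> B j}" "A' = {\<omega>\<in>space M. \<forall>j\<in>J. Y j \<omega> \<in> B' j}"
        by auto
      then show "A \<inter> A' \<in> ?E"
        by (auto intro!: exI[of _ "\<lambda>j. B j \<inter> B' j"])
    qed
    show "?E \<subseteq> sets M"
    proof
      fix A assume "A \<in> ?E"
      then have "A \<in> sets (sigma_family M Y J)"
        unfolding sigma_family_eq_sigma_sets_boxes[OF J] by (rule sigma_sets.Basic)
      then show "A \<in> sets M"
        using subalgebra_sigma_family[of J Y] by (auto simp: subalgebra_def)
    qed
    show "expectation (\<lambda>\<omega>. X \<omega> * indicator A \<omega>) = 0" if "A \<in> ?E" for A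
      using that box by auto
    show "A \<in> sigma_sets (space M) ?E"
      using A unfolding sigma_family_eq_sigma_sets_boxes[OF J] .
  qed
qed

lemma chaos_mean: "X \<in> chaos \<Longrightarrow> expectation X = 0"
proof -
  assume X: "X \<in> chaos"
  \<comment> \<open>For the empty family orthogonality is vacuous, and its trivial field contains
    \<open>space M\<close>.\<close>
  have "expectation (\<lambda>\<omega>. X \<omega> * indicator (space M) \<omega>) = 0"
    using sets.top[of "sigma_family M (\<lambda>_. X) {}"]
    by (intro chaos_orthogonal_integral_zero[OF X, of "{}"]) auto
  also have "expectation (\<lambda>\<omega>. X \<omega> * indicator (space M) \<omega>) = expectation X"
    by (intro Bochner_Integration.integral_cong) auto
  finally show ?thesis .
qed

lemma chaos_covariance:
  "X \<in> chaos \<Longrightarrow> Y \<in> chaos \<Longrightarrow> covariance M X Y = expectation (\<lambda>\<omega>. X \<omega> * Y \<omega>)"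
  by (simp add: covariance_def chaos_mean)

text \<open>\<open>orth\<close> states the normal equations: \<open>X - lin_comb Y J c\<close> is
  orthogonal to every \<open>Y j\<close>, hence integrates to zero over every event of the
  field.\<close>

lemma cond_exp_sigma_family:
  assumes X: "X \<in> chaos" and J: "finite J" and Y: "\<And>j. j \<in> J \<Longrightarrow> Y j \<in> chaos"
    and orth: "\<And>i. i \<in> J \<Longrightarrow>
      expectation (\<lambda>\<omega>. X \<omega> * Y i \<omega>) = expectation (\<lambda>\<omega>. lin_comb Y J c \<omega> * Y i \<omega>)"
  shows "AE \<omega> in M. real_cond_exp M (sigma_family M Y J) X \<omega> = lin_comb Y J c \<omega>"
proof -
  have sub: "subalgebra M (sigma_family M Y J)"
    using Y by (intro subalgebra_sigma_family L2_space_measurable chaos_L2)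
  interpret finite_measure_subalgebra M "sigma_family M Y J"
    by (rule finite_measure_subalgebraI[OF sub])
  have L: "lin_comb Y J c \<in> chaos"
    using Y by (rule chaos_lin_comb)
  note L2 = chaos_L2[OF X] chaos_L2[OF L]
  show ?thesis
  proof (rule real_cond_exp_charact)
    fix A assume A: "A \<in> sets (sigma_family M Y J)"
    then have [measurable]: "A \<in> sets M"
      using sub by (auto simp: subalgebra_def)
    have "expectation (\<lambda>\<omega>. (X \<omega> - lin_comb Y J c \<omega>) * indicator A \<omega>) = 0"
    proof (rule chaos_orthogonal_integral_zero[OF chaos_diff[OF X L] J Y _ A])
      fix j assume j: "j \<in> J"
      show "expectation (\<lambda>\<omega>. (X \<omega> - lin_comb Y J c \<omega>) * Y j \<omega>) = 0"
        using orth[OF j] L2_space_mult_integrable[OF L2(1) chaos_L2[OF Y[OF j]]]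
          L2_space_mult_integrable[OF L2(2) chaos_L2[OF Y[OF j]]]
        by (simp add: left_diff_distrib)
    qed
    moreover have "expectation (\<lambda>\<omega>. (X \<omega> - lin_comb Y J c \<omega>) * indicator A \<omega>)
        = expectation (\<lambda>\<omega>. X \<omega> * indicator A \<omega>) - expectation (\<lambda>\<omega>. lin_comb Y J c \<omega> * indicator A \<omega>)"
      unfolding left_diff_distrib
      by (intro Bochner_Integration.integral_diff L2_space_mult_integrable L2 L2_space_indicator) simp_all
    ultimately show "(\<integral>\<omega>\<in>A. X \<omega> \<partial>M) = (\<integral>\<omega>\<in>A. lin_comb Y J c \<omega> \<partial>M)"
      by (simp add: set_lebesgue_integral_def mult.commute[of _ "indicator A _"])
  qed (auto intro!: L2_space_integrable L2 lin_comb_measurable_sigma_family)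
qed

text \<open>The normal equation for a single regressor has the explicit solution \<open>b\<close>;
  the variable is viewed as a family with the arbitrary index 0.\<close>

lemma cond_exp_sigma_rv:
  assumes X: "X \<in> chaos" and Y: "Y \<in> chaos" and nz: "expectation (\<lambda>\<omega>. (Y \<omega>)\<^sup>2) \<noteq> 0"
  shows "AE \<omega> in M. real_cond_exp M (sigma_rv M Y) X \<omega>
    = expectation (\<lambda>\<omega>. X \<omega> * Y \<omega>) / expectation (\<lambda>\<omega>. (Y \<omega>)\<^sup>2) * Y \<omega>"
proof -
  define b where "b = expectation (\<lambda>\<omega>. X \<omega> * Y \<omega>) / expectation (\<lambda>\<omega>. (Y \<omega>)\<^sup>2)"
  have "space (sigma_rv M Y) = space (sigma_family M (\<lambda>_. Y) {0})"
    by (simp add: sigma_rv_def)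
  then have eq: "real_cond_exp M (sigma_rv M Y) = real_cond_exp M (sigma_family M (\<lambda>_. Y) {0})"
    by (rule real_cond_exp_cong_sets) (simp add: sets_sigma_family_singleton)
  have "expectation (\<lambda>\<omega>. b * Y \<omega> * Y \<omega>) = expectation (\<lambda>\<omega>. b * (Y \<omega>)\<^sup>2)"
    by (simp add: power2_eq_square mult.assoc)
  also have "\<dots> = expectation (\<lambda>\<omega>. X \<omega> * Y \<omega>)"
    using nz by (simp add: b_def)
  finally have "AE \<omega> in M. real_cond_exp M (sigma_family M (\<lambda>_. Y) {0}) X \<omega> = lin_comb (\<lambda>_. Y) {0} (\<lambda>_. b) \<omega>"
    using X Y by (intro cond_exp_sigma_family) (auto simp: lin_comb_def)
  then show ?thesis
    by (simp add: eq lin_comb_def b_def)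
qed

text \<open>The coefficients of the orthogonal projection onto the span of \<open>Y 1, \<dots>, Y n\<close> come from
  the inverse of the covariance matrix.\<close>

lemma projection_coefficients:
  assumes Y: "\<And>i. i \<in> {1..n} \<Longrightarrow> Y i \<in> chaos" and inv: "invertible_mat (cov_matrix M Y n)"
  obtains B :: "nat \<Rightarrow> nat \<Rightarrow> real" where "\<And>U i. U \<in> L2_space M \<Longrightarrow> i \<in> {1..n} \<Longrightarrow>
    expectation (\<lambda>\<omega>. U \<omega> * Y i \<omega>) = expectation (\<lambda>\<omega>.
      lin_comb Y {1..n} (\<lambda>j. \<Sum>k=1..n. B j k * expectation (\<lambda>\<omega>. U \<omega> * Y k \<omega>)) \<omega> * Y i \<omega>)"
proof -
  let ?C = "cov_matrix M Y n"
  obtain C' where C': "?C * C' = 1\<^sub>m n" "C' * ?C = 1\<^sub>m (dim_row C')"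
    using inv by (auto simp: invertible_mat_def inverts_mat_def cov_matrix_def)
  \<comment> \<open>Comparing dimensions in the two identities forces \<open>C'\<close> to be an
    \<open>n\<close> by \<open>n\<close> matrix.\<close>
  have dim: "dim_col C' = n" "dim_row C' = n"
    using arg_cong[OF C'(1), of dim_col] arg_cong[OF C'(2), of dim_col] by (simp_all add: cov_matrix_def)
  have entry: "(\<Sum>j<n. covariance M (Y (Suc i)) (Y (Suc j)) * C' $$ (j, k)) = (if i = k then 1 else 0)"
    if "i < n" "k < n" for i k
  proof -
    have "(?C * C') $$ (i, k) = (\<Sum>j<n. covariance M (Y (Suc i)) (Y (Suc j)) * C' $$ (j, k))"
      using that dim by (simp add: cov_matrix_def scalar_prod_def atLeast0LessThan)
    then show ?thesis
      using that by (simp add: C'(1))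
  qed
  \<comment> \<open>Matrix indices start at 0 and those of \<open>Y\<close> at 1, hence the shift;
    only indices in \<open>{1..n}\<close> occur.\<close>
  define B where "B j k = C' $$ (j - 1, k - 1)" for j k
  have inverse: "(\<Sum>j=1..n. expectation (\<lambda>\<omega>. Y i \<omega> * Y j \<omega>) * B j k) = (if i = k then 1 else 0)"
    if "i \<in> {1..n}" "k \<in> {1..n}" for i k
  proof -
    have "(\<Sum>j=1..n. expectation (\<lambda>\<omega>. Y i \<omega> * Y j \<omega>) * B j k)
        = (\<Sum>j=1..n. covariance M (Y i) (Y j) * B j k)"
      using that Y by (intro sum.cong) (auto simp: chaos_covariance)
    also have "\<dots> = (\<Sum>j<n. covariance M (Y i) (Y (Suc j)) * C' $$ (j, k - 1))"
      by (simp add: sum.atLeast1_atMost_eq B_def)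
    also have "\<dots> = (if i = k then 1 else 0)"
      using entry[of "i - 1" "k - 1"] that by auto
    finally show ?thesis .
  qed
  show thesis
  proof (rule that)
    fix U i assume U: "U \<in> L2_space M" and i: "i \<in> {1..n}"
    define w where "w k = expectation (\<lambda>\<omega>. U \<omega> * Y k \<omega>)" for k
    have "expectation (\<lambda>\<omega>. lin_comb Y {1..n} (\<lambda>j. \<Sum>k=1..n. B j k * w k) \<omega> * Y i \<omega>)
        = expectation (\<lambda>\<omega>. Y i \<omega> * lin_comb Y {1..n} (\<lambda>j. \<Sum>k=1..n. B j k * w k) \<omega>)"
      by (simp add: mult.commute)
    also have "\<dots> = (\<Sum>j=1..n. (\<Sum>k=1..n. B j k * w k) * expectation (\<lambda>\<omega>. Y i \<omega> * Y j \<omega>))"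
      using Y i by (intro expectation_mult_lin_comb) (auto intro: chaos_L2)
    also have "\<dots> = (\<Sum>j=1..n. \<Sum>k=1..n. w k * (expectation (\<lambda>\<omega>. Y i \<omega> * Y j \<omega>) * B j k))"
      by (simp add: sum_distrib_left sum_distrib_right mult_ac)
    also have "\<dots> = (\<Sum>k=1..n. w k * (\<Sum>j=1..n. expectation (\<lambda>\<omega>. Y i \<omega> * Y j \<omega>) * B j k))"
      by (subst sum.swap) (simp add: sum_distrib_left)
    also have "\<dots> = (\<Sum>k=1..n. w k * (if i = k then 1 else 0))"
      by (intro sum.cong refl arg_cong[where f = "\<lambda>x. w _ * x"] inverse i)
    also have "\<dots> = (\<Sum>k=1..n. if k = i then w k else 0)"
      by (intro sum.cong) auto
    also have "\<dots> = w i"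
      using i by simp
    finally show "expectation (\<lambda>\<omega>. U \<omega> * Y i \<omega>) = expectation (\<lambda>\<omega>.
      lin_comb Y {1..n} (\<lambda>j. \<Sum>k=1..n. B j k * expectation (\<lambda>\<omega>. U \<omega> * Y k \<omega>)) \<omega> * Y i \<omega>)"
      by (simp add: w_def)
  qed
qed

text \<open>Orthogonal projection onto the span is self-adjoint and agrees on the chaos with
  conditioning on the field, so it can be moved from \<open>X\<close> to the indicator.
  \<open>c\<close> holds the coefficients of the projection of \<open>indicator A\<close>, which
  itself need not lie in the chaos.\<close>

lemma indicator_represented_by_lin_comb:
  assumes Y: "\<And>i. i \<in> {1..n} \<Longrightarrow> Y i \<in> chaos" and inv: "invertible_mat (cov_matrix M Y n)"
    and A: "A \<in> sets (sigma_family M Y {1..n})"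
  obtains c where "\<And>X. X \<in> chaos \<Longrightarrow>
    expectation (\<lambda>\<omega>. X \<omega> * indicator A \<omega>) = expectation (\<lambda>\<omega>. X \<omega> * lin_comb Y {1..n} c \<omega>)"
proof -
  obtain B where B: "\<And>U i. U \<in> L2_space M \<Longrightarrow> i \<in> {1..n} \<Longrightarrow>
    expectation (\<lambda>\<omega>. U \<omega> * Y i \<omega>) = expectation (\<lambda>\<omega>.
      lin_comb Y {1..n} (\<lambda>j. \<Sum>k=1..n. B j k * expectation (\<lambda>\<omega>. U \<omega> * Y k \<omega>)) \<omega> * Y i \<omega>)"
    using projection_coefficients[OF Y inv] by blast
  define p where "p U = (\<lambda>j. \<Sum>k=1..n. B j k * expectation (\<lambda>\<omega>. U \<omega> * Y k \<omega>))" for U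
  have B: "expectation (\<lambda>\<omega>. U \<omega> * Y i \<omega>) = expectation (\<lambda>\<omega>. lin_comb Y {1..n} (p U) \<omega> * Y i \<omega>)"
    if "U \<in> L2_space M" "i \<in> {1..n}" for U i
    unfolding p_def using that by (rule B)
  have YL2: "Y i \<in> L2_space M" if "i \<in> {1..n}" for i
    using Y[OF that] by (rule chaos_L2)
  have PL2: "lin_comb Y {1..n} c \<in> L2_space M" for c
    using YL2 by (rule lin_comb_L2_space)
  have sub: "subalgebra M (sigma_family M Y {1..n})"
    using YL2 by (intro subalgebra_sigma_family L2_space_measurable)
  interpret finite_measure_subalgebra M "sigma_family M Y {1..n}"
    by (rule finite_measure_subalgebraI[OF sub])
  have AM: "A \<in> sets M"
    using A sub by (auto simp: subalgebra_def)
  \<comment> \<open>Stated for all of L2, because it is applied to \<open>indicator A\<close> as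
    well as to elements of the chaos.\<close>
  have proj: "expectation (\<lambda>\<omega>. U \<omega> * lin_comb Y {1..n} c \<omega>)
      = expectation (\<lambda>\<omega>. lin_comb Y {1..n} (p U) \<omega> * lin_comb Y {1..n} c \<omega>)" if U: "U \<in> L2_space M" for U c
  proof -
    have "expectation (\<lambda>\<omega>. U \<omega> * lin_comb Y {1..n} c \<omega>) = (\<Sum>j=1..n. c j * expectation (\<lambda>\<omega>. U \<omega> * Y j \<omega>))"
      by (rule expectation_mult_lin_comb[OF U YL2])
    also have "\<dots> = (\<Sum>j=1..n. c j * expectation (\<lambda>\<omega>. lin_comb Y {1..n} (p U) \<omega> * Y j \<omega>))"
      by (intro sum.cong refl) (simp only: B[OF U])
    also have "\<dots> = expectation (\<lambda>\<omega>. lin_comb Y {1..n} (p U) \<omega> * lin_comb Y {1..n} c \<omega>)"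
      by (rule expectation_mult_lin_comb[symmetric, OF PL2 YL2])
    finally show ?thesis .
  qed
  have "expectation (\<lambda>\<omega>. X \<omega> * indicator A \<omega>) = expectation (\<lambda>\<omega>. X \<omega> * lin_comb Y {1..n} (p (indicator A)) \<omega>)"
    if X: "X \<in> chaos" for X
  proof -
    have ce: "AE \<omega> in M. real_cond_exp M (sigma_family M Y {1..n}) X \<omega> = lin_comb Y {1..n} (p X) \<omega>"
      using X Y B[OF chaos_L2[OF X]] by (intro cond_exp_sigma_family) auto
    \<comment> \<open>The indicator is measurable for the field, so \<open>X\<close> can be replaced
      by its projection; then \<open>proj\<close> is used twice, for \<open>indicator A\<close> and
      for \<open>X\<close>.\<close>
    have "expectation (\<lambda>\<omega>. indicator A \<omega> * X \<omega>)
        = expectation (\<lambda>\<omega>. indicator A \<omega> * real_cond_exp M (sigma_family M Y {1..n}) X \<omega>)"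
      using A AM chaos_L2[OF X]
      by (intro real_cond_exp_intg(2)[symmetric] L2_space_mult_integrable L2_space_indicator) auto
    also have "\<dots> = expectation (\<lambda>\<omega>. indicator A \<omega> * lin_comb Y {1..n} (p X) \<omega>)"
      using ce AM PL2[of "p X"] by (intro integral_cong_AE) auto
    also have "\<dots> = expectation (\<lambda>\<omega>. lin_comb Y {1..n} (p (indicator A)) \<omega> * lin_comb Y {1..n} (p X) \<omega>)"
      by (rule proj[OF L2_space_indicator[OF AM]])
    also have "\<dots> = expectation (\<lambda>\<omega>. X \<omega> * lin_comb Y {1..n} (p (indicator A)) \<omega>)"
      by (subst proj[OF chaos_L2[OF X]]) (simp add: mult.commute)
    finally show ?thesis
      by (simp add: mult.commute)
  qed
  then show thesis
    by (rule that)
qed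

end

section \<open>Stochastic derivatives\<close>

context prob_space
begin

text \<open>Conditional Jensen for the square, followed by taking expectations.\<close>

lemma cond_exp_L2_contraction:
  assumes G: "subalgebra M G" and f: "f \<in> L2_space M"
  shows "real_cond_exp M G f \<in> L2_space M"
    and "expectation (\<lambda>\<omega>. (real_cond_exp M G f \<omega>)\<^sup>2) \<le> expectation (\<lambda>\<omega>. (f \<omega>)\<^sup>2)"
proof -
  interpret finite_measure_subalgebra M G
    by (rule finite_measure_subalgebraI[OF G])
  \<comment> \<open>The underscores hold the places of the two premises about an interval containing
    the values of \<open>f\<close>.\<close>
  note q = L2_space_integrable[OF f] _ _ L2_space_square_integrable[OF f] convex_power2
  have int: "integrable M (\<lambda>\<omega>. (real_cond_exp M G f \<omega>)\<^sup>2)"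
    by (rule integrable_convex_cond_exp[OF q]) auto
  then show "real_cond_exp M G f \<in> L2_space M"
    by (simp add: L2_space_def)
  have "AE \<omega> in M. (real_cond_exp M G f \<omega>)\<^sup>2 \<le> real_cond_exp M G (\<lambda>\<omega>. (f \<omega>)\<^sup>2) \<omega>"
    by (rule real_cond_exp_jensens_inequality(2)[OF q]) auto
  then have "expectation (\<lambda>\<omega>. (real_cond_exp M G f \<omega>)\<^sup>2)
      \<le> expectation (real_cond_exp M G (\<lambda>\<omega>. (f \<omega>)\<^sup>2))"
    using int real_cond_exp_int(1)[OF L2_space_square_integrable[OF f]] by (intro integral_mono_AE)
  also have "\<dots> = expectation (\<lambda>\<omega>. (f \<omega>)\<^sup>2)"
    by (rule real_cond_exp_int(2)[OF L2_space_square_integrable[OF f]])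
  finally show "expectation (\<lambda>\<omega>. (real_cond_exp M G f \<omega>)\<^sup>2) \<le> expectation (\<lambda>\<omega>. (f \<omega>)\<^sup>2)" .
qed

text \<open>By the tower property the conditional expectation on \<open>H\<close> factors through
  the one on \<open>G\<close>, and conditioning contracts L2 distances.\<close>

lemma L2_stoch_deriv_subalgebra:
  assumes G: "subalgebra M G" and H: "subalgebra G H"
    and D: "L2_stoch_deriv M Z t G D"
    and dq: "\<forall>\<^sub>F h in at 0. diff_quot Z t h \<in> L2_space M"
  shows "L2_stoch_deriv M Z t H (real_cond_exp M H D)"
proof -
  have HM: "subalgebra M H"
    using G H by (auto simp: subalgebra_def)
  interpret H: finite_measure_subalgebra M H
    by (rule finite_measure_subalgebraI[OF HM])
  let ?f = "\<lambda>h. real_cond_exp M G (diff_quot Z t h)"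
  let ?g = "\<lambda>h. real_cond_exp M H (diff_quot Z t h)"
  have DL: "D \<in> L2_space M" and lim: "((\<lambda>h. expectation (\<lambda>\<omega>. (?f h \<omega> - D \<omega>)\<^sup>2)) \<longlongrightarrow> 0) (at 0)"
    using D by (auto simp: L2_stoch_deriv_def L2_tendsto_def)
  have "\<forall>\<^sub>F h in at 0. expectation (\<lambda>\<omega>. (?g h \<omega> - real_cond_exp M H D \<omega>)\<^sup>2)
      \<le> expectation (\<lambda>\<omega>. (?f h \<omega> - D \<omega>)\<^sup>2)"
    using dq
  proof eventually_elim
    case (elim h)
    have f: "?f h \<in> L2_space M"
      by (rule cond_exp_L2_contraction(1)[OF G elim])
    have "AE \<omega> in M. real_cond_exp M H (?f h) \<omega> = ?g h \<omega>"
      by (rule H.real_cond_exp_nested_subalg[OF G H L2_space_integrable[OF elim]])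
    moreover have "AE \<omega> in M. real_cond_exp M H (\<lambda>\<omega>. ?f h \<omega> - D \<omega>) \<omega>
        = real_cond_exp M H (?f h) \<omega> - real_cond_exp M H D \<omega>"
      by (rule H.real_cond_exp_diff[OF L2_space_integrable[OF f] L2_space_integrable[OF DL]])
    ultimately have "AE \<omega> in M. (?g h \<omega> - real_cond_exp M H D \<omega>)\<^sup>2 = (real_cond_exp M H (\<lambda>\<omega>. ?f h \<omega> - D \<omega>) \<omega>)\<^sup>2"
      by eventually_elim simp
    then have "expectation (\<lambda>\<omega>. (?g h \<omega> - real_cond_exp M H D \<omega>)\<^sup>2)
        = expectation (\<lambda>\<omega>. (real_cond_exp M H (\<lambda>\<omega>. ?f h \<omega> - D \<omega>) \<omega>)\<^sup>2)"
      by (intro integral_cong_AE) auto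
    then show ?case
      using cond_exp_L2_contraction(2)[OF HM L2_space_diff[OF f DL]] by simp
  qed
  then have "((\<lambda>h. expectation (\<lambda>\<omega>. (?g h \<omega> - real_cond_exp M H D \<omega>)\<^sup>2)) \<longlongrightarrow> 0) (at 0)"
    by (intro tendsto_sandwich[OF _ _ tendsto_const lim]) auto
  moreover have "\<forall>\<^sub>F h in at 0. ?g h \<in> L2_space M"
    using dq by eventually_elim (rule cond_exp_L2_contraction(1)[OF HM])
  ultimately show ?thesis
    using cond_exp_L2_contraction(1)[OF HM DL] by (simp add: L2_stoch_deriv_def L2_tendsto_def)
qed

text \<open>A \<open>G\<close>-measurable test variable does not see the conditioning. The
  expectations on the left no longer mention \<open>G\<close>, which allows different fields to be
  compared.\<close>

lemma L2_stoch_deriv_integral_mult: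
  assumes G: "subalgebra M G" and D: "L2_stoch_deriv M Z t G D"
    and dq: "\<forall>\<^sub>F h in at 0. diff_quot Z t h \<in> L2_space M"
    and V: "V \<in> L2_space M" "V \<in> borel_measurable G"
  shows "((\<lambda>h. expectation (\<lambda>\<omega>. diff_quot Z t h \<omega> * V \<omega>)) \<longlongrightarrow> expectation (\<lambda>\<omega>. D \<omega> * V \<omega>)) (at 0)"
proof (rule Lim_transform_eventually)
  interpret finite_measure_subalgebra M G
    by (rule finite_measure_subalgebraI[OF G])
  show "((\<lambda>h. expectation (\<lambda>\<omega>. real_cond_exp M G (diff_quot Z t h) \<omega> * V \<omega>)) \<longlongrightarrow> expectation (\<lambda>\<omega>. D \<omega> * V \<omega>)) (at 0)"
    using D V(1) unfolding L2_stoch_deriv_def by (rule L2_tendsto_integral_mult)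
  show "\<forall>\<^sub>F h in at 0. expectation (\<lambda>\<omega>. real_cond_exp M G (diff_quot Z t h) \<omega> * V \<omega>)
      = expectation (\<lambda>\<omega>. diff_quot Z t h \<omega> * V \<omega>)"
    using dq
  proof eventually_elim
    case (elim h)
    show ?case
      using real_cond_exp_intg(2)[OF L2_space_mult_integrable[OF V(1) elim] V(2)] elim
      by (simp add: mult.commute L2_space_measurable)
  qed
qed

text \<open>\<open>D\<close> is given only as an L2 limit of \<open>G\<close>-measurable variables,
  so it is not enough that its conditional expectation vanishes. Testing the approximants against
  \<open>D\<close> itself gives \<open>E D^2 = 0\<close>.\<close>

lemma L2_stoch_deriv_eq_0:
  assumes G: "subalgebra M G" and D: "L2_stoch_deriv M Z t G D"
    and zero: "\<And>A. A \<in> sets G \<Longrightarrow> expectation (\<lambda>\<omega>. D \<omega> * indicator A \<omega>) = 0"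
  shows "AE \<omega> in M. D \<omega> = 0"
proof -
  interpret finite_measure_subalgebra M G
    by (rule finite_measure_subalgebraI[OF G])
  let ?f = "\<lambda>h. real_cond_exp M G (diff_quot Z t h)"
  have DL: "D \<in> L2_space M" and ev: "\<forall>\<^sub>F h in at 0. ?f h \<in> L2_space M"
    using D by (auto simp: L2_stoch_deriv_def L2_tendsto_def)
  have ce: "AE \<omega> in M. real_cond_exp M G D \<omega> = 0"
    using zero DL
    by (intro real_cond_exp_charact)
      (auto simp: set_lebesgue_integral_def mult.commute[of "indicator _ _"] L2_space_integrable)
  have "((\<lambda>h. expectation (\<lambda>\<omega>. ?f h \<omega> * D \<omega>)) \<longlongrightarrow> expectation (\<lambda>\<omega>. D \<omega> * D \<omega>)) (at 0)"
    using D DL unfolding L2_stoch_deriv_def by (rule L2_tendsto_integral_mult)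
  moreover have "\<forall>\<^sub>F h in at 0. expectation (\<lambda>\<omega>. ?f h \<omega> * D \<omega>) = 0"
    using ev
  proof eventually_elim
    case (elim h)
    \<comment> \<open>The approximant is \<open>G\<close>-measurable, so \<open>D\<close> may be
      replaced by its conditional expectation.\<close>
    have "expectation (\<lambda>\<omega>. ?f h \<omega> * D \<omega>) = expectation (\<lambda>\<omega>. ?f h \<omega> * real_cond_exp M G D \<omega>)"
      using DL by (intro real_cond_exp_intg(2)[symmetric] L2_space_mult_integrable elim) auto
    also have "\<dots> = 0"
      using ce by (intro integral_eq_zero_AE) (auto elim: eventually_mono)
    finally show ?case .
  qed
  ultimately have "((\<lambda>h. 0) \<longlongrightarrow> expectation (\<lambda>\<omega>. D \<omega> * D \<omega>)) (at (0::real))"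
    by (rule Lim_transform_eventually)
  then have "expectation (\<lambda>\<omega>. (D \<omega>)\<^sup>2) = 0"
    by (simp add: tendsto_const_iff power2_eq_square)
  then show ?thesis
    using integral_nonneg_eq_0_iff_AE[OF L2_space_square_integrable[OF DL]] by simp
qed

end

context centered_gaussian_space
begin

lemma eventually_diff_quot_chaos:
  assumes "t \<in> {0<..<T}"
  shows "\<forall>\<^sub>F h in at 0. diff_quot Z t h \<in> chaos"
proof -
  have "\<forall>\<^sub>F h in at 0. \<bar>h\<bar> < min t (T - t)"
    using assms by (intro order_tendstoD(2)[OF tendsto_rabs_zero[OF tendsto_ident_at]]) auto
  then show ?thesis
  proof eventually_elim
    case (elim h)
    then show ?case
      using assms by (intro diff_quot_chaos) auto
  qed
qed

lemma eventually_diff_quot_L2: "t \<in> {0<..<T} \<Longrightarrow> \<forall>\<^sub>F h in at 0. diff_quot Z t h \<in> L2_space M"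
  by (drule eventually_diff_quot_chaos) (auto elim: eventually_mono intro: chaos_L2)

text \<open>The joint measurability demanded of a version is inherited by \<open>\<sigma>(\<xi>)\<close> from \<open>G\<close>: although
  \<open>Z\<close> itself need not be measurable in time, the regression coefficient of the difference quotient
  on \<open>\<xi>\<close> is an integral of the given version over \<open>A\<close>.\<close>

lemma nondegenerate_derivative_sigma_rv:
  assumes t: "t \<in> {0<..<T}" and G: "subalgebra M G" and D: "stoch_deriv L2_as M T Z t G D"
    and A: "A \<in> sets G" and \<xi>: "\<xi> \<in> chaos"
    and rep: "\<And>X. X \<in> chaos \<Longrightarrow> expectation (\<lambda>\<omega>. X \<omega> * indicator A \<omega>) = expectation (\<lambda>\<omega>. X \<omega> * \<xi> \<omega>)"
    and nz: "expectation (\<lambda>\<omega>. D \<omega> * indicator A \<omega>) \<noteq> 0"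
  shows "differentiates L2_as M T Z t (sigma_rv M \<xi>)"
    and "\<not> degenerates L2_as M T Z t (sigma_rv M \<xi>)"
proof -
  interpret finite_measure_subalgebra M G
    by (rule finite_measure_subalgebraI[OF G])
  define v where "v = expectation (\<lambda>\<omega>. (\<xi> \<omega>)\<^sup>2)"
  define l where "l = expectation (\<lambda>\<omega>. D \<omega> * indicator A \<omega>)"
  define e where "e h = expectation (\<lambda>\<omega>. diff_quot Z t h \<omega> * \<xi> \<omega>)" for h
  have AM [measurable]: "A \<in> sets M"
    using A G by (auto simp: subalgebra_def)
  have \<xi>L: "\<xi> \<in> L2_space M"
    using \<xi> by (rule chaos_L2)
  then have [measurable]: "\<xi> \<in> borel_measurable M"
    by measurable
  have \<xi>\<sigma>: "\<xi> \<in> borel_measurable (sigma_rv M \<xi>)"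
    unfolding sigma_rv_def by (rule measurable_vimage_algebra1) simp
  have S: "subalgebra M (sigma_rv M \<xi>)"
    by (rule subalgebra_sigma_rv) (auto simp: subalgebra_def)
  note chaos_ev = eventually_diff_quot_chaos[OF t] and L2_ev = eventually_diff_quot_L2[OF t]
  have L2D: "L2_stoch_deriv M Z t G D"
    using D by simp
  have "((\<lambda>h. expectation (\<lambda>\<omega>. diff_quot Z t h \<omega> * indicator A \<omega>)) \<longlongrightarrow> l) (at 0)"
    unfolding l_def using A
    by (intro L2_stoch_deriv_integral_mult[OF G L2D L2_ev] L2_space_indicator[OF AM]) simp
  moreover have "\<forall>\<^sub>F h in at 0. expectation (\<lambda>\<omega>. diff_quot Z t h \<omega> * indicator A \<omega>) = e h"
    using chaos_ev by eventually_elim (simp add: rep e_def)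
  ultimately have e_lim: "(e \<longlongrightarrow> l) (at 0)"
    by (rule Lim_transform_eventually)
  \<comment> \<open>Otherwise \<open>e\<close> would vanish near 0 by Cauchy-Schwarz, against its
    nonzero limit \<open>l\<close>.\<close>
  have v: "v \<noteq> 0"
  proof
    assume v: "v = 0"
    have "\<forall>\<^sub>F h in at 0. e h = 0"
      using L2_ev
    proof eventually_elim
      case (elim h)
      show ?case
        using L2_Cauchy_Schwarz[OF elim \<xi>L] v by (simp add: e_def v_def)
    qed
    with e_lim have "((\<lambda>h. 0) \<longlongrightarrow> l) (at (0::real))"
      by (rule Lim_transform_eventually)
    then show False
      using nz by (simp add: tendsto_const_iff l_def)
  qed
  have ce: "AE \<omega> in M. real_cond_exp M (sigma_rv M \<xi>) (diff_quot Z t h) \<omega> = e h / v * \<xi> \<omega>"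
    if "diff_quot Z t h \<in> chaos" for h
    using cond_exp_sigma_rv[OF that \<xi>] v by (simp add: e_def v_def)
  \<comment> \<open>The limit of the regressions \<open>e h / v * \<xi>\<close> as \<open>h\<close>
    tends to 0.\<close>
  define D' where "D' \<omega> = l / v * \<xi> \<omega>" for \<omega>
  have "L2_stoch_deriv M Z t (sigma_rv M \<xi>) D'"
    unfolding L2_stoch_deriv_def
  proof (rule L2_tendsto_cong_AE)
    have "L2_tendsto M (\<lambda>h. lin_comb (\<lambda>_. \<xi>) {0} (\<lambda>_. e h / v)) (lin_comb (\<lambda>_. \<xi>) {0} (\<lambda>_. l / v)) (at 0)"
      by (intro L2_tendsto_lin_comb \<xi>L tendsto_divide e_lim tendsto_const v)
    then show "L2_tendsto M (\<lambda>h \<omega>. e h / v * \<xi> \<omega>) D' (at 0)"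
      by (simp add: lin_comb_def D'_def[abs_def])
    show "\<forall>\<^sub>F h in at 0. real_cond_exp M (sigma_rv M \<xi>) (diff_quot Z t h) \<in> borel_measurable M \<and>
        (AE \<omega> in M. real_cond_exp M (sigma_rv M \<xi>) (diff_quot Z t h) \<omega> = e h / v * \<xi> \<omega>)"
      using chaos_ev
    proof eventually_elim
      case (elim h)
      show ?case
        using ce[OF elim] by simp
    qed
  qed
  moreover have "as_stoch_deriv M T Z t (sigma_rv M \<xi>) D'"
  proof -
    obtain \<epsilon> q where \<epsilon>: "\<epsilon> > 0" "{t - \<epsilon><..<t + \<epsilon>} \<subseteq> {0<..<T}"
      and q: "(\<lambda>(\<omega>, h). q \<omega> h) \<in> borel_measurable (M \<Otimes>\<^sub>M restrict_space borel {-\<epsilon><..<\<epsilon>})"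
      and qG: "\<And>h. h \<in> {-\<epsilon><..<\<epsilon>} - {0} \<Longrightarrow> (\<lambda>\<omega>. q \<omega> h) \<in> borel_measurable G"
      and qv: "\<And>h. h \<in> {-\<epsilon><..<\<epsilon>} - {0} \<Longrightarrow>
        AE \<omega> in M. q \<omega> h = real_cond_exp M G (diff_quot Z t h) \<omega>"
      using D unfolding stoch_deriv.simps as_stoch_deriv_def by blast
    let ?R = "restrict_space borel {-\<epsilon><..<\<epsilon>} :: real measure"
    \<comment> \<open>\<open>r\<close> equals \<open>e\<close> on the punctured interval and, as a
      parameter integral of the jointly measurable \<open>q\<close>, is measurable in
      \<open>h\<close>; its value at 0 does not affect the limit.\<close>
    define r where "r h = expectation (\<lambda>\<omega>. q \<omega> h * indicator A \<omega>)" for h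
    have chaos_h: "diff_quot Z t h \<in> chaos" if "h \<in> {-\<epsilon><..<\<epsilon>}" for h
    proof -
      have "t + h \<in> {t - \<epsilon><..<t + \<epsilon>}"
        using that by simp
      then have "t + h \<in> {0<..<T}"
        using \<epsilon>(2) by blast
      then show ?thesis
        using t by (intro diff_quot_chaos) simp_all
    qed
    have r: "r h = e h" if h: "h \<in> {-\<epsilon><..<\<epsilon>} - {0}" for h
    proof -
      have dL: "diff_quot Z t h \<in> L2_space M"
        using h by (intro chaos_L2 chaos_h) auto
      have [measurable]: "(\<lambda>\<omega>. q \<omega> h) \<in> borel_measurable M"
        by (rule measurable_from_subalg[OF G qG[OF h]])
      have "r h = expectation (\<lambda>\<omega>. indicator A \<omega> * real_cond_exp M G (diff_quot Z t h) \<omega>)"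
        unfolding r_def using qv[OF h] by (intro integral_cong_AE) auto
      also have "\<dots> = expectation (\<lambda>\<omega>. indicator A \<omega> * diff_quot Z t h \<omega>)"
        using A dL by (intro real_cond_exp_intg(2) L2_space_mult_integrable L2_space_indicator) auto
      also have "\<dots> = e h"
        using rep[OF chaos_h] h by (simp add: e_def mult.commute)
      finally show ?thesis .
    qed
    \<comment> \<open>The components are swapped because
      \<open>borel_measurable_lebesgue_integral\<close> integrates out the second one.\<close>
    have "(\<lambda>(h, \<omega>). q \<omega> h) \<in> borel_measurable (?R \<Otimes>\<^sub>M M)"
      using measurable_pair_swap[OF q] by (simp add: split_beta')
    then have "(\<lambda>p. (case p of (h, \<omega>) \<Rightarrow> q \<omega> h) * indicator A (snd p)) \<in> borel_measurable (?R \<Otimes>\<^sub>M M)"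
      by measurable
    then have "(\<lambda>(h, \<omega>). q \<omega> h * indicator A \<omega>) \<in> borel_measurable (?R \<Otimes>\<^sub>M M)"
      by (simp add: split_beta')
    then have r_meas [measurable]: "r \<in> borel_measurable ?R"
      unfolding r_def[abs_def] by (rule borel_measurable_lebesgue_integral)
    show ?thesis
      unfolding as_stoch_deriv_def
    proof (intro exI[of _ \<epsilon>] exI[of _ "\<lambda>\<omega> h. r h / v * \<xi> \<omega>"] conjI ballI)
      show "(\<lambda>(\<omega>, h). r h / v * \<xi> \<omega>) \<in> borel_measurable (M \<Otimes>\<^sub>M ?R)"
        by measurable
      show "(\<lambda>\<omega>. r h / v * \<xi> \<omega>) \<in> borel_measurable (sigma_rv M \<xi>)" for h
        using \<xi>\<sigma> by (intro borel_measurable_times borel_measurable_const)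
      show "AE \<omega> in M. r h / v * \<xi> \<omega> = real_cond_exp M (sigma_rv M \<xi>) (diff_quot Z t h) \<omega>"
        if h: "h \<in> {-\<epsilon><..<\<epsilon>} - {0}" for h
        using ce[OF chaos_h, of h] h by (auto simp: r elim: eventually_mono)
      have "\<forall>\<^sub>F h in at 0. e h = r h"
        unfolding eventually_at using \<epsilon>(1) by (intro exI[of _ \<epsilon>]) (auto simp: r dist_real_def abs_less_iff)
      with e_lim have "(r \<longlongrightarrow> l) (at 0)"
        by (rule Lim_transform_eventually)
      then show "AE \<omega> in M. ((\<lambda>h. r h / v * \<xi> \<omega>) \<longlongrightarrow> D' \<omega>) (at 0)"
        unfolding D'_def by (intro AE_I2 tendsto_intros v)
    qed (use \<epsilon> in auto)
  qed
  ultimately show "differentiates L2_as M T Z t (sigma_rv M \<xi>)"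
    unfolding differentiates_def by (intro exI[of _ D']) simp
  show "\<not> degenerates L2_as M T Z t (sigma_rv M \<xi>)"
  proof
    \<comment> \<open>A constant derivative \<open>c\<close> would force
      \<open>l = c * E \<xi> = 0\<close>, since elements of the chaos are centered.\<close>
    assume "degenerates L2_as M T Z t (sigma_rv M \<xi>)"
    then obtain E c where E: "L2_stoch_deriv M Z t (sigma_rv M \<xi>) E" and c: "AE \<omega> in M. E \<omega> = c"
      by (auto simp: degenerates_def)
    have EL: "E \<in> L2_space M"
      using E by (simp add: L2_stoch_deriv_def L2_tendsto_def)
    have "(e \<longlongrightarrow> expectation (\<lambda>\<omega>. E \<omega> * \<xi> \<omega>)) (at 0)"
      unfolding e_def[abs_def] by (rule L2_stoch_deriv_integral_mult[OF S E L2_ev \<xi>L \<xi>\<sigma>])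
    moreover have "expectation (\<lambda>\<omega>. E \<omega> * \<xi> \<omega>) = expectation (\<lambda>\<omega>. c * \<xi> \<omega>)"
      using c EL by (intro integral_cong_AE) (auto elim: eventually_mono)
    moreover have "\<dots> = 0"
      using chaos_mean[OF \<xi>] by simp
    ultimately have "l = 0"
      using tendsto_unique[OF _ e_lim] by auto
    then show False
      using nz by (simp add: l_def)
  qed
qed

text \<open>Common core of parts 2 and 3. A nonzero integral of the derivative over an event of
  \<open>E\<close> would turn the projected indicator into a linear combination excluded by
  \<open>lin\<close>. So the derivative integrates to zero over \<open>E\<close>, and by the Dynkin
  argument over all of \<open>G\<close>.\<close>

lemma degenerates_if_lin_combs:
  assumes t: "t \<in> {0<..<T}" and Y: "\<And>i. i \<in> I \<Longrightarrow> Y i \<in> chaos"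
    and inv: "\<And>n. n \<in> I \<Longrightarrow> invertible_mat (cov_matrix M Y n)" and I: "\<And>n. n \<in> I \<Longrightarrow> {1..n} \<subseteq> I"
    and lin: "\<And>J c. finite J \<Longrightarrow> J \<subseteq> I \<Longrightarrow>
      degenerates L2_as M T Z t (sigma_rv M (lin_comb Y J c)) \<or>
      \<not> differentiates L2_as M T Z t (sigma_rv M (lin_comb Y J c))"
    and G: "subalgebra M G"
    and E: "sets G = sigma_sets (space M) E" "Int_stable E"
      "\<And>A. A \<in> E \<Longrightarrow> \<exists>n\<in>I. A \<in> sets (sigma_family M Y {1..n})"
    and diff: "differentiates L2_as M T Z t G"
  shows "degenerates L2_as M T Z t G"
proof -
  obtain D where D: "stoch_deriv L2_as M T Z t G D"
    using diff by (auto simp: differentiates_def)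
  then have L2D: "L2_stoch_deriv M Z t G D"
    by simp
  then have DL: "D \<in> L2_space M"
    by (simp add: L2_stoch_deriv_def L2_tendsto_def)
  have EG: "E \<subseteq> sets G"
    unfolding E(1) by (auto intro: sigma_sets.Basic)
  \<comment> \<open>Testing with the constant 1 gives the mean of \<open>D\<close>, needed for
    complements in the Dynkin argument.\<close>
  have "((\<lambda>h. expectation (\<lambda>\<omega>. diff_quot Z t h \<omega> * 1)) \<longlongrightarrow> expectation (\<lambda>\<omega>. D \<omega> * 1)) (at 0)"
    by (rule L2_stoch_deriv_integral_mult[OF G L2D eventually_diff_quot_L2[OF t]]) (auto simp: L2_space_def)
  moreover have "\<forall>\<^sub>F h in at 0. expectation (\<lambda>\<omega>. diff_quot Z t h \<omega> * 1) = 0"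
    using eventually_diff_quot_chaos[OF t] by eventually_elim (simp add: chaos_mean)
  ultimately have "((\<lambda>h. 0) \<longlongrightarrow> expectation (\<lambda>\<omega>. D \<omega> * 1)) (at (0::real))"
    by (rule Lim_transform_eventually)
  then have mean: "expectation D = 0"
    by (simp add: tendsto_const_iff)
  have "expectation (\<lambda>\<omega>. D \<omega> * indicator A \<omega>) = 0" if A: "A \<in> E" for A
  proof (rule ccontr)
    assume nz: "expectation (\<lambda>\<omega>. D \<omega> * indicator A \<omega>) \<noteq> 0"
    obtain n where n: "n \<in> I" "A \<in> sets (sigma_family M Y {1..n})"
      using E(3)[OF A] by auto
    have Yn: "Y i \<in> chaos" if "i \<in> {1..n}" for i
      using that I[OF n(1)] Y by auto
    obtain c where c: "\<And>X. X \<in> chaos \<Longrightarrow>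
        expectation (\<lambda>\<omega>. X \<omega> * indicator A \<omega>) = expectation (\<lambda>\<omega>. X \<omega> * lin_comb Y {1..n} c \<omega>)"
      using indicator_represented_by_lin_comb[OF Yn inv[OF n(1)] n(2)] by blast
    have "A \<in> sets G"
      using A EG by auto
    note w = nondegenerate_derivative_sigma_rv[OF t G D this chaos_lin_comb[OF Yn] c nz]
    show False
      using lin[OF finite_atLeastAtMost I[OF n(1)], of c] w by blast
  qed
  note zero = this
  have "expectation (\<lambda>\<omega>. D \<omega> * indicator A \<omega>) = 0" if "A \<in> sets G" for A
  proof (rule integral_indicator_zero_Dynkin[OF L2_space_integrable[OF DL] mean E(2) _ zero])
    show "E \<subseteq> sets M"
      using G EG by (auto simp: subalgebra_def)
    show "A \<in> sigma_sets (space M) E"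
      using that by (simp only: E(1))
  qed
  then have "AE \<omega> in M. D \<omega> = 0"
    by (rule L2_stoch_deriv_eq_0[OF G L2D])
  then show ?thesis
    using D by (auto simp: degenerates_def)
qed

section \<open>L2 differentiability of subfields and of finite families\<close>

lemma differentiates_L2_subalgebra:
  assumes "t \<in> {0<..<T}" "subalgebra M G" "subalgebra G H" "differentiates L2 M T Z t G"
  shows "differentiates L2 M T Z t H"
proof -
  obtain D where "L2_stoch_deriv M Z t G D"
    using assms(4) by (auto simp: differentiates_def)
  then have "L2_stoch_deriv M Z t H (real_cond_exp M H D)"
    using assms by (intro L2_stoch_deriv_subalgebra[OF _ _ _ eventually_diff_quot_L2])
  then show ?thesis
    by (auto simp: differentiates_def)
qed

text \<open>The coefficients of the conditional expectation are fixed linear combinations of the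
  covariances \<open>e h k\<close>. Each of these converges, because \<open>Y k\<close> is an
  admissible test variable for its own field.\<close>

lemma differentiates_L2_sigma_family:
  assumes t: "t \<in> {0<..<T}" and Y: "\<And>i. i \<in> {1..n} \<Longrightarrow> Y i \<in> chaos"
    and inv: "invertible_mat (cov_matrix M Y n)"
    and diff: "\<And>i. i \<in> {1..n} \<Longrightarrow> differentiates L2 M T Z t (sigma_rv M (Y i))"
  shows "differentiates L2 M T Z t (sigma_family M Y {1..n})"
proof -
  note L2_ev = eventually_diff_quot_L2[OF t]
  obtain B where B: "\<And>U i. U \<in> L2_space M \<Longrightarrow> i \<in> {1..n} \<Longrightarrow>
    expectation (\<lambda>\<omega>. U \<omega> * Y i \<omega>) = expectation (\<lambda>\<omega>.
      lin_comb Y {1..n} (\<lambda>j. \<Sum>k=1..n. B j k * expectation (\<lambda>\<omega>. U \<omega> * Y k \<omega>)) \<omega> * Y i \<omega>)"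
    using projection_coefficients[OF Y inv] by blast
  have YL: "Y i \<in> L2_space M" if "i \<in> {1..n}" for i
    using Y[OF that] by (rule chaos_L2)
  define e where "e h k = expectation (\<lambda>\<omega>. diff_quot Z t h \<omega> * Y k \<omega>)" for h k
  have "\<exists>v. ((\<lambda>h. e h k) \<longlongrightarrow> v) (at 0)" if k: "k \<in> {1..n}" for k
  proof -
    obtain D where D: "L2_stoch_deriv M Z t (sigma_rv M (Y k)) D"
      using diff[OF k] by (auto simp: differentiates_def)
    have "Y k \<in> borel_measurable M"
      using YL[OF k] by auto
    then have "subalgebra M (sigma_rv M (Y k))"
      by (intro subalgebra_sigma_rv) (auto simp: subalgebra_def)
    moreover have "Y k \<in> borel_measurable (sigma_rv M (Y k))"
      unfolding sigma_rv_def by (rule measurable_vimage_algebra1) simp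
    ultimately show ?thesis
      unfolding e_def using L2_stoch_deriv_integral_mult[OF _ D L2_ev YL[OF k]] by blast
  qed
  then obtain v where v: "\<And>k. k \<in> {1..n} \<Longrightarrow> ((\<lambda>h. e h k) \<longlongrightarrow> v k) (at 0)"
    by metis
  let ?c = "\<lambda>h j. \<Sum>k=1..n. B j k * e h k"
  have "L2_stoch_deriv M Z t (sigma_family M Y {1..n}) (lin_comb Y {1..n} (\<lambda>j. \<Sum>k=1..n. B j k * v k))"
    unfolding L2_stoch_deriv_def
  proof (rule L2_tendsto_cong_AE)
    show "L2_tendsto M (\<lambda>h. lin_comb Y {1..n} (?c h)) (lin_comb Y {1..n} (\<lambda>j. \<Sum>k=1..n. B j k * v k)) (at 0)"
      by (intro L2_tendsto_lin_comb YL tendsto_sum tendsto_mult tendsto_const v)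
    show "\<forall>\<^sub>F h in at 0. real_cond_exp M (sigma_family M Y {1..n}) (diff_quot Z t h) \<in> borel_measurable M \<and>
        (AE \<omega> in M. real_cond_exp M (sigma_family M Y {1..n}) (diff_quot Z t h) \<omega> = lin_comb Y {1..n} (?c h) \<omega>)"
      using eventually_diff_quot_chaos[OF t]
    proof eventually_elim
      case (elim h)
      have "AE \<omega> in M. real_cond_exp M (sigma_family M Y {1..n}) (diff_quot Z t h) \<omega> = lin_comb Y {1..n} (?c h) \<omega>"
        unfolding e_def by (intro cond_exp_sigma_family elim Y B chaos_L2) auto
      then show ?case
        by simp
    qed
  qed
  then show ?thesis
    by (auto simp: differentiates_def)
qed

end

section \<open>Rectangles, index sets and the final assembly\<close>

lemma (in prob_space) rectangle_in_sigma_family: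
  assumes "A \<in> rectangles M Y"
  obtains d where "d \<ge> 1" "A \<in> sets (sigma_family M Y {1..d})"
proof -
  obtain d B where d: "d \<ge> 1" and B: "\<And>i. i \<in> {1..d} \<Longrightarrow> B i \<in> sets (sigma_rv M (Y i))"
    and A: "A = (\<Inter>i\<in>{1..d}. B i)"
    using assms unfolding rectangles_def by blast
  have "A \<in> sets (sigma_family M Y {1..d})"
    unfolding A
  proof (rule sets.finite_INT)
    show "B i \<in> sets (sigma_family M Y {1..d})" if "i \<in> {1..d}" for i
      unfolding sets_sigma_family using that B by (intro sigma_sets.Basic) blast
  qed (use d in auto)
  with d show thesis
    by (rule that)
qed

lemma index_set_simps: "index_set (enat n) = {1..n}" "index_set \<infinity> = {1..}"
  by (auto simp: index_set_def)

lemma index_set_initial: "n \<in> index_set N \<Longrightarrow> {1..n} \<subseteq> index_set N"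
  by (cases N) (auto simp: index_set_simps)

text \<open>The converse in part 2 is stated for fields that do not degenerate \<open>Z\<close>: a
  degenerate field also satisfies the condition on linear combinations, yet it differentiates
  \<open>Z\<close>. The passages from linear combinations back to fields apply
  \<open>degenerates_if_lin_combs\<close> with two different generators.\<close>

theorem theorem1:
  fixes M :: "'a measure"
    and T t :: real
    and Z :: "real \<Rightarrow> 'a \<Rightarrow> real"
    and N :: enat
    and Y :: "nat \<Rightarrow> 'a \<Rightarrow> real"
  assumes "prob_space M"
    and "\<forall>s\<in>{0..T}. Z s \<in> L2_space M"
    and "centered_gaussian_process M T Z"
    and "t \<in> {0<..<T}"
    and "1 \<le> N"
    and "\<forall>i\<in>index_set N. Y i \<in> first_chaos M T Z"
    and "\<forall>n\<in>index_set N. invertible_mat (cov_matrix M Y n)"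
  shows
    "((differentiates L2 M T Z t (sigma_family M Y (index_set N)) \<longrightarrow>
         (\<forall>i\<in>index_set N. differentiates L2 M T Z t (sigma_rv M (Y i)))) \<and>
      (N < \<infinity> \<longrightarrow>
         (\<forall>i\<in>index_set N. differentiates L2 M T Z t (sigma_rv M (Y i))) \<longrightarrow>
         differentiates L2 M T Z t (sigma_family M Y (index_set N))))
     \<and>
     (N < \<infinity> \<longrightarrow>
        (really_not_differentiates L2_as M T Z t (sigma_family M Y (index_set N)) \<longrightarrow>
           (\<forall>J c. finite J \<and> J \<subseteq> index_set N \<longrightarrow>
              degenerates L2_as M T Z t (sigma_rv M (lin_comb Y J c)) \<or>
              \<not> differentiates L2_as M T Z t (sigma_rv M (lin_comb Y J c)))) \<and>
        (\<not> degenerates L2_as M T Z t (sigma_family M Y (index_set N)) \<longrightarrow>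
           (\<forall>J c. finite J \<and> J \<subseteq> index_set N \<longrightarrow>
              degenerates L2_as M T Z t (sigma_rv M (lin_comb Y J c)) \<or>
              \<not> differentiates L2_as M T Z t (sigma_rv M (lin_comb Y J c))) \<longrightarrow>
           really_not_differentiates L2_as M T Z t (sigma_family M Y (index_set N))))
     \<and>
     (N = \<infinity> \<and> iid_family M Y (index_set N) \<longrightarrow>
        (really_not_differentiates L2_as M T Z t (sigma_family M Y (index_set N)) \<longrightarrow>
           (\<forall>J c. finite J \<and> J \<subseteq> index_set N \<longrightarrow>
              degenerates L2_as M T Z t (sigma_rv M (lin_comb Y J c)) \<or>
              \<not> differentiates L2_as M T Z t (sigma_rv M (lin_comb Y J c)))) \<and>
        ((\<forall>J c. finite J \<and> J \<subseteq> index_set N \<longrightarrow>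
              degenerates L2_as M T Z t (sigma_rv M (lin_comb Y J c)) \<or>
              \<not> differentiates L2_as M T Z t (sigma_rv M (lin_comb Y J c))) \<longrightarrow>
           (\<forall>G\<in>rectangle_subalgebras M Y.
              degenerates L2_as M T Z t G \<or> \<not> differentiates L2_as M T Z t G)))"
proof -
  interpret centered_gaussian_space M T Z
    using assms(1-3) by (simp add: centered_gaussian_space_def centered_gaussian_space_axioms_def)
  define I where "I = index_set N"
  define S where "S = sigma_family M Y I"
  define lin where "lin \<longleftrightarrow> (\<forall>J c. finite J \<and> J \<subseteq> I \<longrightarrow>
      degenerates L2_as M T Z t (sigma_rv M (lin_comb Y J c)) \<or>
      \<not> differentiates L2_as M T Z t (sigma_rv M (lin_comb Y J c)))"
  note t = assms(4)
  have Y: "Y i \<in> chaos" if "i \<in> I" for i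
    using that assms(6) by (simp add: I_def)
  have inv: "invertible_mat (cov_matrix M Y n)" if "n \<in> I" for n
    using that assms(7) by (simp add: I_def)
  have I: "{1..n} \<subseteq> I" if "n \<in> I" for n
    using that unfolding I_def by (rule index_set_initial)
  have SM: "subalgebra M S"
    unfolding S_def using Y by (intro subalgebra_sigma_family L2_space_measurable chaos_L2)
  have sub_lin: "subalgebra S (sigma_rv M (lin_comb Y J c))" if "J \<subseteq> I" for J c
    unfolding S_def
    by (rule subalgebra_sigma_rv[OF SM[unfolded S_def] lin_comb_measurable_sigma_family[OF that]])
  have really_lin: lin if really: "really_not_differentiates L2_as M T Z t S"
    unfolding lin_def
  proof (intro allI impI)
    fix J c assume "finite J \<and> J \<subseteq> I"
    then show "degenerates L2_as M T Z t (sigma_rv M (lin_comb Y J c)) \<or>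
        \<not> differentiates L2_as M T Z t (sigma_rv M (lin_comb Y J c))"
      using really sub_lin[of J c] by (simp add: really_not_differentiates_def)
  qed

  have "differentiates L2 M T Z t (sigma_rv M (Y i))" if "differentiates L2 M T Z t S" "i \<in> I" for i
  proof -
    have "Y i \<in> borel_measurable S"
      unfolding S_def using that(2) by (rule measurable_sigma_family)
    then show ?thesis
      by (rule differentiates_L2_subalgebra[OF t SM subalgebra_sigma_rv[OF SM] that(1)])
  qed
  moreover have "differentiates L2 M T Z t S"
    if N: "N < \<infinity>" and diff: "\<forall>i\<in>I. differentiates L2 M T Z t (sigma_rv M (Y i))"
  proof -
    obtain n where "N = enat n"
      using N by (cases N) auto
    then have n: "n \<in> I" "I = {1..n}"
      using assms(5) by (simp_all add: I_def index_set_simps one_enat_def)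
    show ?thesis
      unfolding S_def n(2)
    proof (rule differentiates_L2_sigma_family[OF t])
      show "invertible_mat (cov_matrix M Y n)"
        using n(1) by (rule inv)
      show "Y i \<in> chaos" "differentiates L2 M T Z t (sigma_rv M (Y i))" if "i \<in> {1..n}" for i
        using that diff Y by (simp_all only: n(2) Ball_def)
    qed
  qed
  moreover have "really_not_differentiates L2_as M T Z t S"
    if N: "N < \<infinity>" and nd: "\<not> degenerates L2_as M T Z t S" and lin: lin
  proof -
    obtain n where "N = enat n"
      using N by (cases N) auto
    then have n: "n \<in> I" "I = {1..n}"
      using assms(5) by (simp_all add: I_def index_set_simps one_enat_def)
    \<comment> \<open>All events of \<open>H\<close> depend on the same \<open>n\<close>
      coordinates, so \<open>sets H\<close> itself serves as the generator.\<close>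
    have "degenerates L2_as M T Z t H" if H: "subalgebra S H" "differentiates L2_as M T Z t H" for H
    proof (rule degenerates_if_lin_combs[OF t Y inv I])
      show HM: "subalgebra M H"
        using SM H(1) by (auto simp: subalgebra_def)
      then show "sets H = sigma_sets (space M) (sets H)"
        using sets.sigma_sets_eq[of H] by (simp add: subalgebra_def)
      show "Int_stable (sets H)"
        by (auto simp: Int_stable_def)
      show "\<exists>n\<in>I. A \<in> sets (sigma_family M Y {1..n})" if "A \<in> sets H" for A
      proof
        show "A \<in> sets (sigma_family M Y {1..n})"
          using that H(1) n(2) by (auto simp: subalgebra_def S_def)
      qed (fact n(1))
    qed (use lin H(2) in \<open>simp_all add: lin_def\<close>)
    \<comment> \<open>Taking \<open>H = S\<close> shows that a differentiating \<open>S\<close>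
      would degenerate, contrary to \<open>nd\<close>.\<close>
    moreover have "subalgebra S S"
      by (simp add: subalgebra_def)
    ultimately show ?thesis
      using nd unfolding really_not_differentiates_def by blast
  qed
  moreover have "degenerates L2_as M T Z t G"
    if N: "N = \<infinity>" and lin: lin and G: "G \<in> rectangle_subalgebras M Y"
      and diff: "differentiates L2_as M T Z t G" for G
  proof -
    have I1: "I = {1..}"
      using N by (simp add: I_def index_set_simps)
    obtain C where GS: "subalgebra S G" and C: "C \<subseteq> rectangles M Y" "sets G = sigma_sets (space M) C"
      using G by (auto simp: rectangle_subalgebras_def S_def I1)
    \<comment> \<open>A family \<open>C\<close> of rectangles need not be intersection-stable.
      \<open>P\<close> enlarges it to all events of \<open>G\<close> that depend on finitely many
      coordinates, and these are.\<close>
    define P where "P = {A \<in> sets G. \<exists>n\<in>I. A \<in> sets (sigma_family M Y {1..n})}"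
    have GM: "subalgebra M G"
      using SM GS by (auto simp: subalgebra_def)
    show ?thesis
    proof (rule degenerates_if_lin_combs[OF t Y inv I _ GM _ _ _ diff])
      have "C \<subseteq> P"
      proof
        fix A assume A: "A \<in> C"
        then have "A \<in> rectangles M Y"
          using C(1) by blast
        then obtain d where "d \<ge> 1" "A \<in> sets (sigma_family M Y {1..d})"
          by (rule rectangle_in_sigma_family)
        moreover have "A \<in> sets G"
          using A unfolding C(2) by (rule sigma_sets.Basic)
        ultimately show "A \<in> P"
          unfolding P_def I1 by blast
      qed
      then have "sets G \<subseteq> sigma_sets (space M) P"
        unfolding C(2) by (rule sigma_sets_mono')
      moreover have "sigma_sets (space M) P \<subseteq> sets G"
        using GM sets.sigma_sets_subset[of P G] by (auto simp: P_def subalgebra_def)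
      ultimately show "sets G = sigma_sets (space M) P"
        by simp
      show "Int_stable P"
      proof (rule Int_stableI)
        fix A B assume "A \<in> P" "B \<in> P"
        then obtain m n where G: "A \<in> sets G" "B \<in> sets G"
          and m: "m \<in> I" "A \<in> sets (sigma_family M Y {1..m})"
          and n: "n \<in> I" "B \<in> sets (sigma_family M Y {1..n})"
          unfolding P_def by blast
        \<comment> \<open>Both events depend only on the first \<open>max m n\<close> coordinates,
          hence so does their intersection.\<close>
        define k where "k = max m n"
        have "sets (sigma_family M Y {1..m}) \<subseteq> sets (sigma_family M Y {1..k})"
          "sets (sigma_family M Y {1..n}) \<subseteq> sets (sigma_family M Y {1..k})"
          by (rule sigma_family_mono; simp add: k_def)+
        then have "A \<inter> B \<in> sets (sigma_family M Y {1..k})"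
          using m(2) n(2) by blast
        moreover have "k \<in> I"
          using m(1) by (simp add: I1 k_def)
        ultimately show "A \<inter> B \<in> P"
          using sets.Int[OF G] unfolding P_def by blast
      qed
      show "\<exists>n\<in>I. A \<in> sets (sigma_family M Y {1..n})" if "A \<in> P" for A
        using that by (simp add: P_def)
    qed (use lin in \<open>simp_all add: lin_def\<close>)
  qed
  ultimately show ?thesis
    using really_lin unfolding I_def[symmetric] S_def[symmetric] lin_def[symmetric] by blast
qed

end
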